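(* Bounded $\mathrm{LTL}_{\mathbb{R}}$ verification of Memoryful Neural Multi-Agent Systems is decidable: there is an algorithm which, given a linearly definable MN-MAS $S$ and a bounded $\mathrm{LTL}_{\mathbb{R}}$ formula $\phi$, decides whether $S\models\phi$.
   Context: A Memoryful Neural Multi-Agent System (MN-MAS) $S$ consists of: an environment state space $\mathcal{X}\subseteq\mathbb{R}^m$ with initial states $\mathcal{X}^{(0)}\subseteq\mathcal{X}$; $s$ agents, agent $i$ having an action space $\mathcal{A}_i$, observation space $\mathcal{O}_i$, observation function $o_i:\mathcal{X}\to\mathcal{O}_i$, hidden-state set $\mathcal{H}_i\subseteq\mathbb{R}^{n_i}$ with initial hidden states $\mathcal{H}_i^{(0)}$, and recurrent policy $r_i:\mathcal{O}_i\times\mathcal{H}_i\to\mathcal{A}_i\times\mathcal{H}_i$; and a non-deterministic transition relation $\tau:\mathcal{X}\times\mathcal{A}\to2^{\mathcal{X}}$, $\mathcal{A}=\prod_i\mathcal{A}_i$. With $\mathcal{H}=\prod_i\mathcal{H}_i$, $\mathcal{H}^{(0)}=\prod_i\mathcal{H}^{(0)}_i$, $o=(o_1,\dots,o_s)$, $r=(r_1,\dots,r_s)$, a path is $\pi=(\bm{x}^{(0)},\bm{h}^{(0)},\bm{x}^{(1)},\bm{h}^{(1)},\dots)$ with $(\bm{a}^{(t)},\bm{h}^{(t+1)})=r(o(\bm{x}^{(t)}),\bm{h}^{(t)})$ and $\bm{x}^{(t+1)}\in\tau(\bm{x}^{(t)},\bm{a}^{(t)})$. Linearly definable means $\tau,r,o,\mathcal{X}^{(0)},\mathcal{H}^{(0)}$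 are expressible by finite conjunctions and disjunctions of linear inequalities with rational coefficients (and $S$ is given by these constraints). $\mathrm{LTL}_{\mathbb{R}}$ formulae: $\phi::=\bm{c}^{\top}\bm{x}\le d\mid\neg\phi\mid\phi\wedge\phi\mid\phi\vee\phi\mid\bigcirc\phi\mid\phi\,\mathcal{U}\,\phi\mid\phi\,\mathcal{R}\,\phi\mid\square\phi\mid\lozenge\phi$ ($\bm{c}\in\mathbb{R}^m,d\in\mathbb{R}$); a formula is bounded if it contains none of $\mathcal{U},\mathcal{R},\square,\lozenge$. Semantics at time $t$ of path $\pi$: atoms hold iff $\bm{c}^{\top}\bm{x}^{(t)}\le d$; Boolean connectives as usual; $\bigcirc\phi$ holds at $t$ iff $\phi$ holds at $t+1$. $S\models\phi$ means $\phi$ holds at time $0$ on every path with $\bm{x}^{(0)}\in\mathcal{X}^{(0)}$, $\bm{h}^{(0)}\in\mathcal{H}^{(0)}$.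
   Formalization: Paths are infinite, so the system is assumed deadlock-free (every reachable configuration has a successor; otherwise the problem is undecidable), and the formula's real coefficients are given by names from a subfield of the reals with computable arithmetic and decidable order. *)

theory Defs
  imports Complex_Main "HOL-Library.Nat_Bijection"
begin

section \<open>General recursive functions\<close>

text \<open>
  \<open>recursive_fn n f\<close>: on argument lists of length \<open>n\<close>, the function \<open>f\<close> is a total general
  recursive function in Kleene's sense (minimisation is applied to regular functions only).
  Values on lists of any other length carry no information.
\<close>

inductive recursive_fn :: "nat \<Rightarrow> (nat list \<Rightarrow> nat) \<Rightarrow> bool" where
  rec_zero: "recursive_fn n (\<lambda>_. 0)"
| rec_succ: "recursive_fn 1 (\<lambda>xs. Suc (xs ! 0))"
| rec_proj: "i < n \<Longrightarrow> recursive_fn n (\<lambda>xs. xs ! i)"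
| rec_comp: "recursive_fn (length gs) f \<Longrightarrow> \<forall>g\<in>set gs. recursive_fn n g \<Longrightarrow>
    recursive_fn n (\<lambda>xs. f (map (\<lambda>g. g xs) gs))"
| rec_prim: "recursive_fn n f \<Longrightarrow> recursive_fn (Suc (Suc n)) g \<Longrightarrow>
    recursive_fn (Suc n)
      (\<lambda>xs. rec_nat (f (tl xs)) (\<lambda>k r. g (k # r # tl xs)) (hd xs))"
| rec_mu: "recursive_fn (Suc n) f \<Longrightarrow> \<forall>xs. length xs = n \<longrightarrow> (\<exists>y. f (y # xs) = 0) \<Longrightarrow>
    recursive_fn n (\<lambda>xs. LEAST y. f (y # xs) = 0)"

text \<open>
  An algorithm cannot receive arbitrary real numbers.  Real coefficients are therefore handed over
  as names, where \<open>\<nu>\<close> assigns to every name the real number it denotes.  The numbers that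
  have a name must form a subfield of the reals with computable arithmetic and decidable order;
  negation and inversion on names are then computable by search.  The rationals are an instance
  (lemma \<open>effective_ordered_field_rat\<close> below), the real algebraic numbers are another.
\<close>

definition effective_ordered_field :: "(nat \<Rightarrow> real) \<Rightarrow> bool" where
  "effective_ordered_field \<nu> \<longleftrightarrow>
     1 \<in> range \<nu> \<and> (\<forall>a. - \<nu> a \<in> range \<nu>) \<and> (\<forall>a. inverse (\<nu> a) \<in> range \<nu>) \<and>
     (\<exists>f. recursive_fn 2 f \<and> (\<forall>a b. \<nu> (f [a, b]) = \<nu> a + \<nu> b)) \<and>
     (\<exists>f. recursive_fn 2 f \<and> (\<forall>a b. \<nu> (f [a, b]) = \<nu> a * \<nu> b)) \<and>
     (\<exists>f. recursive_fn 2 f \<and> (\<forall>a b. f [a, b] = (if \<nu> a \<le> \<nu> b then 1 else 0)))"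


definition rec_ext :: "nat \<Rightarrow> (nat list \<Rightarrow> nat) \<Rightarrow> bool" where
  "rec_ext n f \<longleftrightarrow> (\<exists>g. recursive_fn n g \<and> (\<forall>xs. length xs = n \<longrightarrow> g xs = f xs))"

lemma rec_ext_cong:
  "rec_ext n f \<Longrightarrow> (\<And>xs. length xs = n \<Longrightarrow> f xs = g xs) \<Longrightarrow> rec_ext n g"
  unfolding rec_ext_def by metis

lemma rec_ext_proj: "i < n \<Longrightarrow> rec_ext n (\<lambda>xs. xs ! i)"
  unfolding rec_ext_def using rec_proj by blast

lemma rec_ext_zero: "rec_ext n (\<lambda>_. 0)"
  unfolding rec_ext_def using rec_zero by blast

lemma rec_ext_comp1:
  assumes "rec_ext 1 (\<lambda>xs. f (xs ! 0))" "rec_ext n g"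
  shows "rec_ext n (\<lambda>xs. f (g xs))"
proof -
  obtain f' g' where f': "recursive_fn 1 f'" "\<forall>xs. length xs = 1 \<longrightarrow> f' xs = f (xs ! 0)"
    and g': "recursive_fn n g'" "\<forall>xs. length xs = n \<longrightarrow> g' xs = g xs"
    using assms unfolding rec_ext_def by blast
  have "recursive_fn n (\<lambda>xs. f' (map (\<lambda>g. g xs) [g']))"
    by (rule rec_comp) (use f' g' in auto)
  then show ?thesis
    unfolding rec_ext_def by (intro exI conjI, assumption) (use f' g' in auto)
qed

lemma rec_ext_comp2:
  assumes "rec_ext 2 (\<lambda>xs. f (xs ! 0) (xs ! 1))" "rec_ext n g" "rec_ext n h"
  shows "rec_ext n (\<lambda>xs. f (g xs) (h xs))"
proof -
  obtain f' g' h' where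
    f': "recursive_fn 2 f'" "\<forall>xs. length xs = 2 \<longrightarrow> f' xs = f (xs ! 0) (xs ! 1)"
    and g': "recursive_fn n g'" "\<forall>xs. length xs = n \<longrightarrow> g' xs = g xs"
    and h': "recursive_fn n h'" "\<forall>xs. length xs = n \<longrightarrow> h' xs = h xs"
    using assms unfolding rec_ext_def by blast
  have "recursive_fn n (\<lambda>xs. f' (map (\<lambda>g. g xs) [g', h']))"
    by (rule rec_comp) (use f' g' h' in \<open>auto simp: numeral_2_eq_2\<close>)
  then show ?thesis
    unfolding rec_ext_def by (intro exI conjI, assumption) (use f' g' h' in auto)
qed

lemma rec_ext_prim:
  assumes "rec_ext n f" "rec_ext (Suc (Suc n)) g"
  shows "rec_ext (Suc n) (\<lambda>xs. rec_nat (f (tl xs)) (\<lambda>k r. g (k # r # tl xs)) (hd xs))"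
proof -
  obtain f' g' where f': "recursive_fn n f'" "\<forall>xs. length xs = n \<longrightarrow> f' xs = f xs"
    and g': "recursive_fn (Suc (Suc n)) g'" "\<forall>xs. length xs = Suc (Suc n) \<longrightarrow> g' xs = g xs"
    using assms unfolding rec_ext_def by blast
  have "rec_nat (f' (tl xs)) (\<lambda>k r. g' (k # r # tl xs)) k =
        rec_nat (f (tl xs)) (\<lambda>k r. g (k # r # tl xs)) k" if "length xs = Suc n" for xs k
    by (induction k) (use that f' g' in auto)
  then show ?thesis
    unfolding rec_ext_def using rec_prim[OF f'(1) g'(1)] by blast
qed

lemma rec_ext_mu:
  assumes "rec_ext (Suc n) f" "\<And>xs. length xs = n \<Longrightarrow> \<exists>y. f (y # xs) = 0"
  shows "rec_ext n (\<lambda>xs. LEAST y. f (y # xs) = 0)"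
proof -
  obtain f' where f': "recursive_fn (Suc n) f'" "\<forall>xs. length xs = Suc n \<longrightarrow> f' xs = f xs"
    using assms unfolding rec_ext_def by blast
  have "recursive_fn n (\<lambda>xs. LEAST y. f' (y # xs) = 0)"
    by (rule rec_mu) (use f' assms in auto)
  then show ?thesis
    unfolding rec_ext_def by (intro exI conjI, assumption) (use f' in auto)
qed

lemma rec_ext_Suc: "rec_ext n g \<Longrightarrow> rec_ext n (\<lambda>xs. Suc (g xs))"
  by (rule rec_ext_comp1) (use rec_succ in \<open>auto simp: rec_ext_def\<close>)

lemma length_2_conv: "length xs = 2 \<longleftrightarrow> (\<exists>a b. xs = [a, b])"
  by (auto simp: numeral_2_eq_2 length_Suc_conv)

lemma length_1_conv: "length xs = Suc 0 \<longleftrightarrow> (\<exists>a. xs = [a])"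
  by (auto simp: length_Suc_conv)

lemma rec_ext_add:
  assumes "rec_ext n g" "rec_ext n h"
  shows "rec_ext n (\<lambda>xs. g xs + h xs)"
proof (rule rec_ext_comp2[OF _ assms])
  have "rec_ext (Suc 1) (\<lambda>xs. rec_nat (tl xs ! 0) (\<lambda>k r. Suc ((k # r # tl xs) ! 1)) (hd xs))"
    by (rule rec_ext_prim) (auto intro: rec_ext_proj rec_ext_Suc)
  then show "rec_ext 2 (\<lambda>xs. xs ! 0 + xs ! 1)"
    unfolding Suc_1
  proof (rule rec_ext_cong)
    have "rec_nat b (\<lambda>k r. Suc r) a = a + b" for a b :: nat
      by (induction a) auto
    then show "rec_nat (tl xs ! 0) (\<lambda>k r. Suc ((k # r # tl xs) ! 1)) (hd xs) = xs ! 0 + xs ! 1"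
      if "length xs = 2" for xs :: "nat list"
      using that by (auto simp: length_2_conv)
  qed
qed

lemma rec_ext_mult:
  assumes "rec_ext n g" "rec_ext n h"
  shows "rec_ext n (\<lambda>xs. g xs * h xs)"
proof (rule rec_ext_comp2[OF _ assms])
  have "rec_ext (Suc 1) (\<lambda>xs. rec_nat 0
      (\<lambda>k r. (k # r # tl xs) ! 1 + (k # r # tl xs) ! 2) (hd xs))"
    by (rule rec_ext_prim) (auto intro!: rec_ext_proj rec_ext_add rec_ext_zero)
  then show "rec_ext 2 (\<lambda>xs. xs ! 0 * xs ! 1)"
    unfolding Suc_1
  proof (rule rec_ext_cong)
    have "rec_nat 0 (\<lambda>k r. r + b) a = a * b" for a b :: nat
      by (induction a) auto
    then show "rec_nat 0 (\<lambda>k r. (k # r # tl xs) ! 1 + (k # r # tl xs) ! 2) (hd xs) =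
        xs ! 0 * xs ! 1"
      if "length xs = 2" for xs :: "nat list"
      using that by (auto simp: length_2_conv)
  qed
qed

lemma rec_ext_pred:
  assumes "rec_ext n g"
  shows "rec_ext n (\<lambda>xs. g xs - 1)"
proof (rule rec_ext_comp1[OF _ assms])
  have "rec_ext (Suc 0) (\<lambda>xs. rec_nat 0 (\<lambda>k r. (k # r # tl xs) ! 0) (hd xs))"
    by (rule rec_ext_prim) (auto intro!: rec_ext_proj rec_ext_zero)
  then show "rec_ext 1 (\<lambda>xs. xs ! 0 - 1)"
    unfolding One_nat_def
  proof (rule rec_ext_cong)
    have "rec_nat 0 (\<lambda>k r. k) a = a - Suc 0" for a :: nat
      by (cases a) auto
    then show "rec_nat 0 (\<lambda>k r. (k # r # tl xs) ! 0) (hd xs) = xs ! 0 - Suc 0"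
      if "length xs = Suc 0" for xs :: "nat list"
      using that by (auto simp: length_1_conv)
  qed
qed

lemma rec_ext_diff:
  assumes "rec_ext n g" "rec_ext n h"
  shows "rec_ext n (\<lambda>xs. g xs - h xs)"
proof (rule rec_ext_comp2[where f = "\<lambda>b a. a - b", OF _ assms(2,1)])
  have "rec_ext (Suc 1) (\<lambda>xs. rec_nat (tl xs ! 0) (\<lambda>k r. (k # r # tl xs) ! 1 - 1) (hd xs))"
    by (rule rec_ext_prim) (auto intro!: rec_ext_proj rec_ext_pred[unfolded One_nat_def])
  then show "rec_ext 2 (\<lambda>xs. xs ! 1 - xs ! 0)"
    unfolding Suc_1
  proof (rule rec_ext_cong)
    have "rec_nat b (\<lambda>k r. r - Suc 0) a = b - a" for a b :: nat
      by (induction a) auto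
    then show "rec_nat (tl xs ! 0) (\<lambda>k r. (k # r # tl xs) ! 1 - 1) (hd xs) = xs ! 1 - xs ! 0"
      if "length xs = 2" for xs :: "nat list"
      using that by (auto simp: length_2_conv)
  qed
qed

lemma rec_ext_le:
  assumes "rec_ext n g" "rec_ext n h"
  shows "rec_ext n (\<lambda>xs. if g xs \<le> h xs then 1 else 0)"
  by (rule rec_ext_cong[OF rec_ext_diff[OF rec_ext_Suc[OF rec_ext_zero] rec_ext_diff[OF assms]]])
    auto

lemma rec_ext_triangle:
  assumes "rec_ext n g"
  shows "rec_ext n (\<lambda>xs. triangle (g xs))"
proof (rule rec_ext_comp1[OF _ assms])
  have "rec_ext (Suc 0) (\<lambda>xs. rec_nat 0
      (\<lambda>k r. (k # r # tl xs) ! 1 + Suc ((k # r # tl xs) ! 0)) (hd xs))"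
    by (rule rec_ext_prim) (auto intro!: rec_ext_proj rec_ext_zero rec_ext_add rec_ext_Suc
      simp del: add_Suc_right)
  then show "rec_ext 1 (\<lambda>xs. triangle (xs ! 0))"
    unfolding One_nat_def
  proof (rule rec_ext_cong)
    have "rec_nat 0 (\<lambda>k r. r + Suc k) a = triangle a" for a :: nat
      by (induction a) auto
    then show "rec_nat 0 (\<lambda>k r. (k # r # tl xs) ! Suc 0 + Suc ((k # r # tl xs) ! 0)) (hd xs) =
        triangle (xs ! 0)"
      if "length xs = Suc 0" for xs :: "nat list"
      using that by (auto simp: length_1_conv)
  qed
qed

lemma rec_ext_prod_encode:
  assumes "rec_ext n g" "rec_ext n h"
  shows "rec_ext n (\<lambda>xs. prod_encode (g xs, h xs))"
  unfolding prod_encode_def by (auto intro!: rec_ext_add rec_ext_triangle assms)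

lemma triangle_mono: "a \<le> b \<Longrightarrow> triangle a \<le> triangle b"
  by (induction b) (auto simp: le_Suc_eq)

lemma prod_decode_Least:
  "(LEAST t. prod_encode (a, b) < triangle (Suc t)) = a + b"
proof (rule Least_equality)
  show "prod_encode (a, b) < triangle (Suc (a + b))"
    by (simp add: prod_encode_def)
  show "a + b \<le> t" if "prod_encode (a, b) < triangle (Suc t)" for t
  proof (rule ccontr)
    assume "\<not> a + b \<le> t"
    then have "triangle (Suc t) \<le> triangle (a + b)" by (intro triangle_mono) auto
    then show False using that by (simp add: prod_encode_def)
  qed
qed

lemma rec_ext_prod_decode:
  assumes "rec_ext n g"
  shows "rec_ext n (\<lambda>xs. fst (prod_decode (g xs)))" "rec_ext n (\<lambda>xs. snd (prod_decode (g xs)))"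
proof -
  define w where "w k = (LEAST t. Suc k - triangle (Suc t) = 0)" for k
  have w: "w (prod_encode (a, b)) = a + b" for a b
    using prod_decode_Least[of a b] by (simp add: w_def less_eq_Suc_le)
  have fst_eq: "fst (prod_decode k) = k - triangle (w k)"
    and snd_eq: "snd (prod_decode k) = w k - (k - triangle (w k))" for k
  proof -
    obtain a b where k: "k = prod_encode (a, b)" by (metis prod_decode_inverse surj_pair)
    have "k = triangle (a + b) + a" "w k = a + b" "prod_decode k = (a, b)"
      by (simp_all add: k w) (simp add: prod_encode_def)
    then show "fst (prod_decode k) = k - triangle (w k)"
      "snd (prod_decode k) = w k - (k - triangle (w k))"
      by simp_all
  qed
  have "rec_ext 1 (\<lambda>xs. LEAST t. Suc ((t # xs) ! 1) - triangle (Suc ((t # xs) ! 0)) = 0)"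
  proof (rule rec_ext_mu)
    show "rec_ext (Suc 1) (\<lambda>xs. Suc (xs ! 1) - triangle (Suc (xs ! 0)))"
      by (intro rec_ext_diff rec_ext_Suc rec_ext_triangle rec_ext_proj) auto
    have "k \<le> triangle k" for k by (induction k) auto
    then show "\<exists>y. Suc ((y # xs) ! 1) - triangle (Suc ((y # xs) ! 0)) = 0" for xs
      by (intro exI[of _ "xs ! 0"]) (simp add: le_Suc_eq)
  qed
  then have w1: "rec_ext 1 (\<lambda>xs. w (xs ! 0))"
    by (rule rec_ext_cong) (simp add: w_def)
  have w: "rec_ext n (\<lambda>xs. w (g xs))"
    by (rule rec_ext_comp1[OF w1 assms])
  show "rec_ext n (\<lambda>xs. fst (prod_decode (g xs)))" "rec_ext n (\<lambda>xs. snd (prod_decode (g xs)))"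
    unfolding fst_eq snd_eq by (intro rec_ext_diff rec_ext_triangle assms w)+
qed

text \<open>The name \<open>\<langle>p, \<langle>q, d\<rangle>\<rangle>\<close> denotes \<open>(p - q) / (d + 1)\<close>.\<close>

definition rat_name :: "nat \<Rightarrow> real" where
  "rat_name k = (case prod_decode k of (p, e) \<Rightarrow> case prod_decode e of (q, d) \<Rightarrow>
     (real p - real q) / (real d + 1))"

lemma rat_name_encode:
  "rat_name (prod_encode (p, prod_encode (q, d))) = (real p - real q) / (real d + 1)"
  by (simp add: rat_name_def)

lemma range_rat_name: "range rat_name = \<rat>"
proof
  show "range rat_name \<subseteq> \<rat>"
    by (auto simp: rat_name_def split: prod.splits)
  show "\<rat> \<subseteq> range rat_name"
  proof
    fix x :: real assume "x \<in> \<rat>"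
    then obtain a b :: int where ab: "b > 0" "x = of_int a / of_int b"
      by (rule Rats_cases') blast
    have "x = rat_name (prod_encode (nat a, prod_encode (nat (- a), nat (b - 1))))"
      using ab by (simp add: rat_name_encode)
    then show "x \<in> range rat_name" by blast
  qed
qed

lemma effective_ordered_field_rat: "effective_ordered_field rat_name"
proof -
  let ?P = "\<lambda>k. fst (prod_decode k)" and ?Q = "\<lambda>k. fst (prod_decode (snd (prod_decode k)))"
    and ?D = "\<lambda>k. Suc (snd (prod_decode (snd (prod_decode k))))"
  have name: "rat_name k = (real (?P k) - real (?Q k)) / real (?D k)" for k
    by (simp add: rat_name_def split: prod.splits)
  have pos: "real (?D k) > 0" for k by simp
  have frac: "(pa * db + pb * da - (qa * db + qb * da)) / (da * db) = (pa - qa) / da + (pb - qb) / db"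
    "(pa * pb + qa * qb - (pa * qb + qa * pb)) / (da * db) = (pa - qa) / da * ((pb - qb) / db)"
    "(pa - qa) / da \<le> (pb - qb) / db \<longleftrightarrow> pa * db + qb * da \<le> pb * da + qa * db"
    if "da > 0" "db > 0" for pa pb qa qb da db :: real
    using that by (simp_all add: field_simps)
  define s where "s a b = prod_encode (?P a * ?D b + ?P b * ?D a,
      prod_encode (?Q a * ?D b + ?Q b * ?D a, ?D a * ?D b - 1))" for a b
  define m where "m a b = prod_encode (?P a * ?P b + ?Q a * ?Q b,
      prod_encode (?P a * ?Q b + ?Q a * ?P b, ?D a * ?D b - 1))" for a b
  have D: "real (?D a * ?D b - 1) + 1 = real (?D a) * real (?D b)" for a b
    by (simp add: algebra_simps)
  have "rec_ext 2 (\<lambda>xs. s (xs ! 0) (xs ! 1))"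
    unfolding s_def by (intro rec_ext_prod_encode rec_ext_add rec_ext_pred rec_ext_mult
      rec_ext_prod_decode rec_ext_Suc rec_ext_proj) auto
  then obtain f where f: "recursive_fn 2 f" "\<And>a b. f [a, b] = s a b"
    unfolding rec_ext_def by (fastforce simp: length_2_conv)
  have s: "rat_name (s a b) = rat_name a + rat_name b" for a b
    unfolding s_def rat_name_encode D unfolding name of_nat_add of_nat_mult
    by (rule frac(1)[OF pos pos])
  have "rec_ext 2 (\<lambda>xs. m (xs ! 0) (xs ! 1))"
    unfolding m_def by (intro rec_ext_prod_encode rec_ext_add rec_ext_pred rec_ext_mult
      rec_ext_prod_decode rec_ext_Suc rec_ext_proj) auto
  then obtain g where g: "recursive_fn 2 g" "\<And>a b. g [a, b] = m a b"
    unfolding rec_ext_def by (fastforce simp: length_2_conv)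
  have m: "rat_name (m a b) = rat_name a * rat_name b" for a b
    unfolding m_def rat_name_encode D unfolding name of_nat_add of_nat_mult
    by (rule frac(2)[OF pos pos])
  define l :: "nat \<Rightarrow> nat \<Rightarrow> nat" where
    "l a b = (if ?P a * ?D b + ?Q b * ?D a \<le> ?P b * ?D a + ?Q a * ?D b then 1 else 0)" for a b
  have "rec_ext 2 (\<lambda>xs. l (xs ! 0) (xs ! 1))"
    unfolding l_def by (intro rec_ext_le rec_ext_add rec_ext_mult
      rec_ext_prod_decode rec_ext_Suc rec_ext_proj) auto
  then obtain h where h: "recursive_fn 2 h" "\<And>a b. h [a, b] = l a b"
    unfolding rec_ext_def by (fastforce simp: length_2_conv)
  have l: "l a b = (if rat_name a \<le> rat_name b then 1 else 0)" for a b
  proof -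
    have "rat_name a \<le> rat_name b \<longleftrightarrow>
        real (?P a * ?D b + ?Q b * ?D a) \<le> real (?P b * ?D a + ?Q a * ?D b)"
      unfolding name of_nat_add of_nat_mult by (rule frac(3)[OF pos pos])
    then show ?thesis unfolding l_def of_nat_le_iff by simp
  qed
  have R: "rat_name a \<in> \<rat>" for a using range_rat_name by blast
  show ?thesis
    unfolding effective_ordered_field_def range_rat_name
  proof (intro conjI)
    show "\<exists>f. recursive_fn 2 f \<and> (\<forall>a b. rat_name (f [a, b]) = rat_name a + rat_name b)"
      using f s by auto
    show "\<exists>f. recursive_fn 2 f \<and> (\<forall>a b. rat_name (f [a, b]) = rat_name a * rat_name b)"
      using g m by auto
    show "\<exists>f. recursive_fn 2 f \<and> (\<forall>a b. f [a, b] = (if rat_name a \<le> rat_name b then 1 else 0))"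
      using h l by auto
  qed (use R in auto)
qed


section \<open>Memoryful neural multi-agent systems\<close>

text \<open>Vectors of \<open>\<real>\<^sup>n\<close> are lists of length \<open>n\<close>, since the dimensions are part of the input.\<close>

definition vec :: "nat \<Rightarrow> real list set" where
  "vec n = {v. length v = n}"

definition dot :: "real list \<Rightarrow> real list \<Rightarrow> real" where
  "dot c v = (\<Sum>i<length c. c ! i * v ! i)"

text \<open>The Cartesian product of a list of sets.\<close>

definition cart :: "'a set list \<Rightarrow> 'a list set" where
  "cart As = {xs. list_all2 (\<in>) xs As}"

record agent =
  act_dim :: nat
  obs_dim :: nat
  hid_dim :: nat
  actions :: "real list set"
  observations :: "real list set"
  hiddens :: "real list set"
  init_hiddens :: "real list set"
  observe :: "real list \<Rightarrow> real list"
  policy :: "real list \<times> real list \<Rightarrow> real list \<times> real list"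

record mas =
  env_dim :: nat
  env :: "real list set"
  init_env :: "real list set"
  agents :: "agent list"
  transition :: "real list \<Rightarrow> real list list \<Rightarrow> real list set"

definition joint_actions :: "mas \<Rightarrow> real list list set" where
  "joint_actions S = cart (map actions (agents S))"

definition joint_hiddens :: "mas \<Rightarrow> real list list set" where
  "joint_hiddens S = cart (map hiddens (agents S))"

definition joint_init_hiddens :: "mas \<Rightarrow> real list list set" where
  "joint_init_hiddens S = cart (map init_hiddens (agents S))"

definition joint_observations :: "mas \<Rightarrow> real list list set" where
  "joint_observations S = cart (map observations (agents S))"

definition joint_observe :: "mas \<Rightarrow> real list \<Rightarrow> real list list" where
  "joint_observe S x = map (\<lambda>ag. observe ag x) (agents S)"

definition joint_policy ::
    "mas \<Rightarrow> real list list \<times> real list list \<Rightarrow> real list list \<times> real list list" where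
  "joint_policy S = (\<lambda>(os, hs).
     let rs = map2 policy (agents S) (zip os hs) in (map fst rs, map snd rs))"

definition mn_agent :: "real list set \<Rightarrow> agent \<Rightarrow> bool" where
  "mn_agent X ag \<longleftrightarrow>
     actions ag \<subseteq> vec (act_dim ag) \<and>
     observations ag \<subseteq> vec (obs_dim ag) \<and>
     hiddens ag \<subseteq> vec (hid_dim ag) \<and>
     init_hiddens ag \<subseteq> hiddens ag \<and>
     (\<forall>x\<in>X. observe ag x \<in> observations ag) \<and>
     (\<forall>p\<in>observations ag \<times> hiddens ag. policy ag p \<in> actions ag \<times> hiddens ag)"

definition mn_mas :: "mas \<Rightarrow> bool" where
  "mn_mas S \<longleftrightarrow>
     env S \<subseteq> vec (env_dim S) \<and>
     init_env S \<subseteq> env S \<and>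
     (\<forall>ag\<in>set (agents S). mn_agent (env S) ag) \<and>
     (\<forall>x\<in>env S. \<forall>a\<in>joint_actions S. transition S x a \<subseteq> env S)"

text \<open>A path \<open>(x\<^sup>0, h\<^sup>0, x\<^sup>1, h\<^sup>1, \<dots>)\<close> is given by its two component sequences.\<close>

definition path :: "mas \<Rightarrow> (nat \<Rightarrow> real list) \<Rightarrow> (nat \<Rightarrow> real list list) \<Rightarrow> bool" where
  "path S x h \<longleftrightarrow>
     (\<forall>t. x t \<in> env S \<and> h t \<in> joint_hiddens S \<and>
       (\<exists>a. (a, h (Suc t)) = joint_policy S (joint_observe S (x t), h t) \<and>
            x (Suc t) \<in> transition S (x t) a))"

text \<open>
  Paths are infinite.  For this to be adequate, the system must not get stuck: whenever a finite run
  from an initial state has been built, the environment has a next state.  This holds in particular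
  if \<open>transition S x a\<close> is never empty (lemma \<open>deadlock_free_total\<close> below).  Without
  such a condition even the question whether any path exists is undecidable, because piecewise affine maps
  simulate Turing machines.
\<close>

inductive reachable :: "mas \<Rightarrow> real list \<Rightarrow> real list list \<Rightarrow> bool" for S where
  init: "x \<in> init_env S \<Longrightarrow> h \<in> joint_init_hiddens S \<Longrightarrow> reachable S x h"
| step: "reachable S x h \<Longrightarrow> (a, h') = joint_policy S (joint_observe S x, h) \<Longrightarrow>
    x' \<in> transition S x a \<Longrightarrow> reachable S x' h'"

definition deadlock_free :: "mas \<Rightarrow> bool" where
  "deadlock_free S \<longleftrightarrow>
     (\<forall>x h. reachable S x h \<longrightarrow>
        transition S x (fst (joint_policy S (joint_observe S x, h))) \<noteq> {})"


lemma joint_policy_in: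
  assumes S: "mn_mas S" and x: "x \<in> env S" and h: "h \<in> joint_hiddens S"
    and r: "joint_policy S (joint_observe S x, h) = (a, h')"
  shows "a \<in> joint_actions S" "h' \<in> joint_hiddens S"
proof -
  have len: "length h = length (agents S)"
    and hi: "\<And>i. i < length (agents S) \<Longrightarrow> h ! i \<in> hiddens (agents S ! i)"
    using h by (auto simp: joint_hiddens_def cart_def list_all2_conv_all_nth)
  have pol: "policy (agents S ! i) (observe (agents S ! i) x, h ! i)
      \<in> actions (agents S ! i) \<times> hiddens (agents S ! i)" if i: "i < length (agents S)" for i
  proof -
    have "mn_agent (env S) (agents S ! i)" using S i by (auto simp: mn_mas_def)
    then show ?thesis using x hi[OF i] unfolding mn_agent_def by blast
  qed
  have a: "a = map fst (map2 policy (agents S) (zip (joint_observe S x) h))"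
    and h': "h' = map snd (map2 policy (agents S) (zip (joint_observe S x) h))"
    using r by (auto simp: joint_policy_def Let_def)
  show "a \<in> joint_actions S"
    using pol len by (auto simp: a joint_actions_def joint_observe_def cart_def
      list_all2_conv_all_nth mem_Times_iff)
  show "h' \<in> joint_hiddens S"
    using pol len by (auto simp: h' joint_hiddens_def joint_observe_def cart_def
      list_all2_conv_all_nth mem_Times_iff)
qed

lemma reachable_in:
  assumes "mn_mas S" "reachable S x h"
  shows "x \<in> env S \<and> h \<in> joint_hiddens S"
  using assms(2)
proof induction
  case (init x h)
  have "init_hiddens (agents S ! i) \<subseteq> hiddens (agents S ! i)" if "i < length (agents S)" for i
    using that assms(1) by (auto simp: mn_mas_def mn_agent_def)
  then have "list_all2 (\<in>) h (map hiddens (agents S))"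
    using init(2) by (fastforce simp: joint_init_hiddens_def cart_def list_all2_conv_all_nth)
  then show ?case
    using init(1) assms(1) by (auto simp: mn_mas_def joint_hiddens_def cart_def)
next
  case (step x h a h' x')
  then show ?case
    using joint_policy_in[OF assms(1), of x h a h'] assms(1) unfolding mn_mas_def by (metis subsetD)
qed

lemma deadlock_free_total:
  assumes "mn_mas S" "\<And>x a. x \<in> env S \<Longrightarrow> a \<in> joint_actions S \<Longrightarrow> transition S x a \<noteq> {}"
  shows "deadlock_free S"
  unfolding deadlock_free_def
  using assms reachable_in joint_policy_in(1) by (metis prod.collapse)


section \<open>Linear temporal logic over the reals\<close>

datatype 'a ltl =
    Atom "'a list" 'a
  | Neg "'a ltl"
  | Conj "'a ltl" "'a ltl"
  | Disj "'a ltl" "'a ltl"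
  | Next "'a ltl"
  | Until "'a ltl" "'a ltl"
  | Release "'a ltl" "'a ltl"
  | Always "'a ltl"
  | Eventually "'a ltl"

primrec ltl_over :: "nat \<Rightarrow> 'a ltl \<Rightarrow> bool" where
  "ltl_over m (Atom c d) \<longleftrightarrow> length c = m"
| "ltl_over m (Neg p) \<longleftrightarrow> ltl_over m p"
| "ltl_over m (Conj p q) \<longleftrightarrow> ltl_over m p \<and> ltl_over m q"
| "ltl_over m (Disj p q) \<longleftrightarrow> ltl_over m p \<and> ltl_over m q"
| "ltl_over m (Next p) \<longleftrightarrow> ltl_over m p"
| "ltl_over m (Until p q) \<longleftrightarrow> ltl_over m p \<and> ltl_over m q"
| "ltl_over m (Release p q) \<longleftrightarrow> ltl_over m p \<and> ltl_over m q"
| "ltl_over m (Always p) \<longleftrightarrow> ltl_over m p"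
| "ltl_over m (Eventually p) \<longleftrightarrow> ltl_over m p"

primrec bounded_ltl :: "'a ltl \<Rightarrow> bool" where
  "bounded_ltl (Atom c d) \<longleftrightarrow> True"
| "bounded_ltl (Neg p) \<longleftrightarrow> bounded_ltl p"
| "bounded_ltl (Conj p q) \<longleftrightarrow> bounded_ltl p \<and> bounded_ltl q"
| "bounded_ltl (Disj p q) \<longleftrightarrow> bounded_ltl p \<and> bounded_ltl q"
| "bounded_ltl (Next p) \<longleftrightarrow> bounded_ltl p"
| "bounded_ltl (Until p q) \<longleftrightarrow> False"
| "bounded_ltl (Release p q) \<longleftrightarrow> False"
| "bounded_ltl (Always p) \<longleftrightarrow> False"
| "bounded_ltl (Eventually p) \<longleftrightarrow> False"

primrec ltl_holds :: "(nat \<Rightarrow> real list) \<Rightarrow> nat \<Rightarrow> real ltl \<Rightarrow> bool" where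
  "ltl_holds x t (Atom c d) \<longleftrightarrow> dot c (x t) \<le> d"
| "ltl_holds x t (Neg p) \<longleftrightarrow> \<not> ltl_holds x t p"
| "ltl_holds x t (Conj p q) \<longleftrightarrow> ltl_holds x t p \<and> ltl_holds x t q"
| "ltl_holds x t (Disj p q) \<longleftrightarrow> ltl_holds x t p \<or> ltl_holds x t q"
| "ltl_holds x t (Next p) \<longleftrightarrow> ltl_holds x (Suc t) p"
| "ltl_holds x t (Until p q) \<longleftrightarrow>
     (\<exists>k\<ge>t. ltl_holds x k q \<and> (\<forall>j. t \<le> j \<and> j < k \<longrightarrow> ltl_holds x j p))"
| "ltl_holds x t (Release p q) \<longleftrightarrow>
     (\<forall>k\<ge>t. ltl_holds x k q \<or> (\<exists>j. t \<le> j \<and> j < k \<and> ltl_holds x j p))"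
| "ltl_holds x t (Always p) \<longleftrightarrow> (\<forall>k\<ge>t. ltl_holds x k p)"
| "ltl_holds x t (Eventually p) \<longleftrightarrow> (\<exists>k\<ge>t. ltl_holds x k p)"

definition mas_models :: "mas \<Rightarrow> real ltl \<Rightarrow> bool" where
  "mas_models S p \<longleftrightarrow>
     (\<forall>x h. path S x h \<and> x 0 \<in> init_env S \<and> h 0 \<in> joint_init_hiddens S \<longrightarrow>
        ltl_holds x 0 p)"


section \<open>Linear descriptions\<close>

datatype lin =
    Le "rat list" rat
  | Less "rat list" rat
  | And lin lin
  | Or lin lin

primrec lin_over :: "nat \<Rightarrow> lin \<Rightarrow> bool" where
  "lin_over n (Le c d) \<longleftrightarrow> length c = n"
| "lin_over n (Less c d) \<longleftrightarrow> length c = n"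
| "lin_over n (And p q) \<longleftrightarrow> lin_over n p \<and> lin_over n q"
| "lin_over n (Or p q) \<longleftrightarrow> lin_over n p \<and> lin_over n q"

primrec lin_holds :: "real list \<Rightarrow> lin \<Rightarrow> bool" where
  "lin_holds v (Le c d) \<longleftrightarrow> dot (map of_rat c) v \<le> of_rat d"
| "lin_holds v (Less c d) \<longleftrightarrow> dot (map of_rat c) v < of_rat d"
| "lin_holds v (And p q) \<longleftrightarrow> lin_holds v p \<and> lin_holds v q"
| "lin_holds v (Or p q) \<longleftrightarrow> lin_holds v p \<or> lin_holds v q"

text \<open>
  The finite data by which a linearly definable system is given.  Each entry of \<open>d_agents\<close>
  consists of the action, observation and hidden-state dimension of an agent.
\<close>

record mas_desc =
  d_env_dim :: nat
  d_agents :: "(nat \<times> nat \<times> nat) list"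
  d_trans :: lin
  d_policy :: lin
  d_observe :: lin
  d_init_env :: lin
  d_init_hiddens :: lin

definition joint_vec :: "nat list \<Rightarrow> real list list set" where
  "joint_vec ns = cart (map vec ns)"

text \<open>
  \<open>describes D S\<close>: the constraints in \<open>D\<close> define \<open>\<tau>\<close>, \<open>r\<close>, \<open>o\<close>,
  \<open>X\<^sup>0\<close> and \<open>H\<^sup>0\<close>.  Functions and relations are defined through their
  graphs, over the concatenation of all vectors involved; the constraints may be arbitrary outside
  the domain of the function.
\<close>

definition describes :: "mas_desc \<Rightarrow> mas \<Rightarrow> bool" where
  "describes D S \<longleftrightarrow>
    (let m = env_dim S;
         qs = map act_dim (agents S); ps = map obs_dim (agents S); ns = map hid_dim (agents S)
     in
       d_env_dim D = m \<and>
       d_agents D = map (\<lambda>ag. (act_dim ag, obs_dim ag, hid_dim ag)) (agents S) \<and>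
       lin_over (m + sum_list qs + m) (d_trans D) \<and>
       (\<forall>x\<in>env S. \<forall>a\<in>joint_actions S. \<forall>x'\<in>vec m.
          lin_holds (x @ concat a @ x') (d_trans D) \<longleftrightarrow> x' \<in> transition S x a) \<and>
       lin_over (sum_list ps + sum_list ns + sum_list qs + sum_list ns) (d_policy D) \<and>
       (\<forall>y\<in>joint_observations S. \<forall>h\<in>joint_hiddens S. \<forall>a\<in>joint_vec qs. \<forall>h'\<in>joint_vec ns.
          lin_holds (concat y @ concat h @ concat a @ concat h') (d_policy D) \<longleftrightarrow>
          joint_policy S (y, h) = (a, h')) \<and>
       lin_over (m + sum_list ps) (d_observe D) \<and>
       (\<forall>x\<in>env S. \<forall>y\<in>joint_vec ps.
          lin_holds (x @ concat y) (d_observe D) \<longleftrightarrow> joint_observe S x = y) \<and>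
       lin_over m (d_init_env D) \<and>
       (\<forall>x\<in>vec m. lin_holds x (d_init_env D) \<longleftrightarrow> x \<in> init_env S) \<and>
       lin_over (sum_list ns) (d_init_hiddens D) \<and>
       (\<forall>h\<in>joint_vec ns.
          lin_holds (concat h) (d_init_hiddens D) \<longleftrightarrow> h \<in> joint_init_hiddens S))"


section \<open>Encoding of the input\<close>

definition rat_encode :: "rat \<Rightarrow> nat" where
  "rat_encode r = (case quotient_of r of (a, b) \<Rightarrow> prod_encode (int_encode a, int_encode b))"

primrec lin_encode :: "lin \<Rightarrow> nat" where
  "lin_encode (Le c d) =
     prod_encode (0, prod_encode (list_encode (map rat_encode c), rat_encode d))"
| "lin_encode (Less c d) =
     prod_encode (1, prod_encode (list_encode (map rat_encode c), rat_encode d))"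
| "lin_encode (And p q) = prod_encode (2, prod_encode (lin_encode p, lin_encode q))"
| "lin_encode (Or p q) = prod_encode (3, prod_encode (lin_encode p, lin_encode q))"

definition desc_encode :: "mas_desc \<Rightarrow> nat" where
  "desc_encode D = list_encode
     [d_env_dim D,
      list_encode (map (\<lambda>(q, p, n). list_encode [q, p, n]) (d_agents D)),
      lin_encode (d_trans D), lin_encode (d_policy D), lin_encode (d_observe D),
      lin_encode (d_init_env D), lin_encode (d_init_hiddens D)]"

primrec ltl_encode :: "nat ltl \<Rightarrow> nat" where
  "ltl_encode (Atom c d) = prod_encode (0, prod_encode (list_encode c, d))"
| "ltl_encode (Neg p) = prod_encode (1, ltl_encode p)"
| "ltl_encode (Conj p q) = prod_encode (2, prod_encode (ltl_encode p, ltl_encode q))"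
| "ltl_encode (Disj p q) = prod_encode (3, prod_encode (ltl_encode p, ltl_encode q))"
| "ltl_encode (Next p) = prod_encode (4, ltl_encode p)"
| "ltl_encode (Until p q) = prod_encode (5, prod_encode (ltl_encode p, ltl_encode q))"
| "ltl_encode (Release p q) = prod_encode (6, prod_encode (ltl_encode p, ltl_encode q))"
| "ltl_encode (Always p) = prod_encode (7, ltl_encode p)"
| "ltl_encode (Eventually p) = prod_encode (8, ltl_encode p)"

end

theory Submission
  imports Defs
begin

text \<open>
  A violation of a bounded formula with at most \<open>k\<close> nested occurrences of \<open>\<circle>\<close> is visible on the first
  \<open>k + 1\<close> states of a path, and by deadlock freedom every finite run extends to a path.  Hence
  \<open>S \<Turnstile> \<phi>\<close> fails iff a Boolean combination of linear inequalities in the finitely many coordinates of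
  such a run is satisfiable.  Each disjunct of its disjunctive normal form is decided by
  Fourier--Motzkin elimination, which needs only sums, products and comparisons of coefficients.

  To see that this procedure is recursive, it is written with ordinary functions on lists, numbers and
  reals, and a function is called computable if a recursive function on codes tracks it; computability
  is then derived along the structure of the definitions.
\<close>

section \<open>Computable functions on represented types\<close>

text \<open>The sets \<open>env S\<close> and \<open>joint_hiddens S\<close> are not part of a
  description \<open>D\<close>, and outside them its constraints say nothing about \<open>S\<close>.
  A solution of the inequalities is therefore not evidently a run of \<open>S\<close>. Membership is
  recovered state by state: the initial constraints are exact on all vectors of the right dimension,
  and a step from a reachable state leads to a reachable state, where the constraints are meaningful
  again. Negated atoms are strict inequalities, so elimination has to handle strict and weak rows
  together; this dictates how a value is chosen between lower and upper bounds. Function types have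
  no codes. Combinators such as \<open>foldl\<close> and \<open>map\<close> therefore take a
  functional argument as a function computable jointly in its arguments and a surrounding parameter,
  which is what lets the closure rules pass under abstractions.\<close>

definition rec_unary :: "(nat \<Rightarrow> nat) \<Rightarrow> bool" where
  "rec_unary g \<longleftrightarrow> rec_ext 1 (\<lambda>xs. g (xs ! 0))"

lemma rec_unary_comp: "rec_unary f \<Longrightarrow> rec_unary g \<Longrightarrow> rec_unary (\<lambda>n. f (g n))"
  unfolding rec_unary_def by (rule rec_ext_comp1)

lemma rec_unary_id: "rec_unary (\<lambda>n. n)"
  unfolding rec_unary_def by (rule rec_ext_proj) simp

lemma rec_unary_const: "rec_unary (\<lambda>_. k)"
  unfolding rec_unary_def by (induction k) (auto intro: rec_ext_zero rec_ext_Suc)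

lemma rec_unary_Suc: "rec_unary f \<Longrightarrow> rec_unary (\<lambda>n. Suc (f n))"
  unfolding rec_unary_def by (rule rec_ext_Suc)

lemma rec_unary_pred: "rec_unary f \<Longrightarrow> rec_unary (\<lambda>n. f n - 1)"
  unfolding rec_unary_def by (rule rec_ext_pred)

lemma rec_unary_add: "rec_unary f \<Longrightarrow> rec_unary g \<Longrightarrow> rec_unary (\<lambda>n. f n + g n)"
  unfolding rec_unary_def by (rule rec_ext_add)

lemma rec_unary_mult: "rec_unary f \<Longrightarrow> rec_unary g \<Longrightarrow> rec_unary (\<lambda>n. f n * g n)"
  unfolding rec_unary_def by (rule rec_ext_mult)

lemma rec_unary_le:
  "rec_unary f \<Longrightarrow> rec_unary g \<Longrightarrow> rec_unary (\<lambda>n. if f n \<le> g n then 1 else 0)"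
  unfolding rec_unary_def by (rule rec_ext_le)

lemma rec_unary_pair:
  "rec_unary f \<Longrightarrow> rec_unary g \<Longrightarrow> rec_unary (\<lambda>n. prod_encode (f n, g n))"
  unfolding rec_unary_def by (rule rec_ext_prod_encode)

lemma rec_unary_fst: "rec_unary f \<Longrightarrow> rec_unary (\<lambda>n. fst (prod_decode (f n)))"
  unfolding rec_unary_def by (rule rec_ext_prod_decode)

lemma rec_unary_snd: "rec_unary f \<Longrightarrow> rec_unary (\<lambda>n. snd (prod_decode (f n)))"
  unfolding rec_unary_def by (rule rec_ext_prod_decode)

lemma rec_unary_recursive_fn2:
  assumes "recursive_fn 2 f" "rec_unary g" "rec_unary h"
  shows "rec_unary (\<lambda>n. f [g n, h n])"
proof -
  have "rec_ext 2 (\<lambda>xs. f [xs ! 0, xs ! 1])"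
    unfolding rec_ext_def by (rule exI[of _ f]) (use assms(1) in \<open>auto simp: length_2_conv\<close>)
  then show ?thesis
    using assms(2,3) unfolding rec_unary_def by (rule rec_ext_comp2)
qed

text \<open>Parameter, counter and accumulator are packed into one code. \<open>rec_prim\<close>
  recurses on its first argument, so the recursion is set up as a binary function with the parameter
  last, and \<open>j n\<close> and \<open>n\<close> are substituted afterwards.\<close>

lemma rec_unary_rec_nat:
  assumes f: "rec_unary f" and g: "rec_unary g" and j: "rec_unary j"
  shows "rec_unary (\<lambda>n. rec_nat (f n) (\<lambda>k r. g (prod_encode (n, prod_encode (k, r)))) (j n))"
proof -
  have "rec_ext (Suc 1) (\<lambda>xs. rec_nat (f (tl xs ! 0))
      (\<lambda>k r. g (prod_encode ((k # r # tl xs) ! 2, prod_encode ((k # r # tl xs) ! 0, (k # r # tl xs) ! 1))))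
      (hd xs))"
    by (rule rec_ext_prim)
      (use f g in \<open>auto simp: rec_unary_def intro!: rec_ext_prod_encode rec_ext_proj
        intro: rec_ext_comp1[of g]\<close>)
  then have "rec_ext 2 (\<lambda>xs. rec_nat (f (xs ! 1))
      (\<lambda>k r. g (prod_encode (xs ! 1, prod_encode (k, r)))) (xs ! 0))"
    unfolding Suc_1 by (rule rec_ext_cong) (auto simp: length_2_conv)
  from rec_ext_comp2[OF this j[unfolded rec_unary_def] rec_unary_id[unfolded rec_unary_def]]
  show ?thesis
    unfolding rec_unary_def .
qed

lemma rec_unary_Least:
  assumes "rec_unary f" "\<And>n. \<exists>y. f (prod_encode (y, n)) = 0"
  shows "rec_unary (\<lambda>n. LEAST y. f (prod_encode (y, n)) = 0)"
proof -
  have "rec_ext 1 (\<lambda>xs. LEAST y. f (prod_encode ((y # xs) ! 0, (y # xs) ! 1)) = 0)"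
    by (rule rec_ext_mu)
      (use assms in \<open>auto simp: rec_unary_def intro!: rec_ext_prod_encode rec_ext_proj
        intro: rec_ext_comp1[of f]\<close>)
  then show ?thesis by (simp add: rec_unary_def)
qed

text \<open>
  \<open>represents \<nu> n x\<close>: the number \<open>n\<close> is a code of \<open>x\<close>.  An object may have several codes or none
  at all, because a real number is coded by any of its names under \<open>\<nu>\<close>.
\<close>

class represented =
  fixes represents :: "(nat \<Rightarrow> real) \<Rightarrow> nat \<Rightarrow> 'a \<Rightarrow> bool"

instantiation nat :: represented
begin
definition represents_nat :: "(nat \<Rightarrow> real) \<Rightarrow> nat \<Rightarrow> nat \<Rightarrow> bool" where
  [simp]: "represents_nat \<nu> n x \<longleftrightarrow> n = x"
instance ..
end

instantiation bool :: represented
begin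
definition represents_bool :: "(nat \<Rightarrow> real) \<Rightarrow> nat \<Rightarrow> bool \<Rightarrow> bool" where
  [simp]: "represents_bool \<nu> n b \<longleftrightarrow> n = of_bool b"
instance ..
end

instantiation real :: represented
begin
definition represents_real :: "(nat \<Rightarrow> real) \<Rightarrow> nat \<Rightarrow> real \<Rightarrow> bool" where
  [simp]: "represents_real \<nu> n x \<longleftrightarrow> \<nu> n = x"
instance ..
end

instantiation prod :: (represented, represented) represented
begin
definition represents_prod :: "(nat \<Rightarrow> real) \<Rightarrow> nat \<Rightarrow> 'a \<times> 'b \<Rightarrow> bool" where
  "represents_prod \<nu> n p \<longleftrightarrow>
     represents \<nu> (fst (prod_decode n)) (fst p) \<and> represents \<nu> (snd (prod_decode n)) (snd p)"
instance ..
end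

instantiation list :: (represented) represented
begin
definition represents_list :: "(nat \<Rightarrow> real) \<Rightarrow> nat \<Rightarrow> 'a list \<Rightarrow> bool" where
  "represents_list \<nu> n xs \<longleftrightarrow> list_all2 (represents \<nu>) (list_decode n) xs"
instance ..
end

instantiation rat :: represented
begin
definition represents_rat :: "(nat \<Rightarrow> real) \<Rightarrow> nat \<Rightarrow> rat \<Rightarrow> bool" where
  [simp]: "represents_rat \<nu> n x \<longleftrightarrow> n = rat_encode x"
instance ..
end

instantiation lin :: represented
begin
definition represents_lin :: "(nat \<Rightarrow> real) \<Rightarrow> nat \<Rightarrow> lin \<Rightarrow> bool" where
  [simp]: "represents_lin \<nu> n p \<longleftrightarrow> n = lin_encode p"
instance ..
end

lemma represents_Pair [simp]:
  "represents \<nu> (prod_encode (a, b)) (x, y) \<longleftrightarrow> represents \<nu> a x \<and> represents \<nu> b y"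
  by (simp add: represents_prod_def)

lemma represents_list_encode [simp]:
  "represents \<nu> (list_encode ns) xs \<longleftrightarrow> list_all2 (represents \<nu>) ns xs"
  by (simp add: represents_list_def)

text \<open>Numbers code themselves, so a list of numbers has exactly one code. This is why
  \<open>list_encode\<close> and \<open>list_decode\<close> are later tracked by the
  identity.\<close>

lemma represents_nat_list [simp]: "represents \<nu> n (xs :: nat list) \<longleftrightarrow> n = list_encode xs"
proof -
  have "represents \<nu> = ((=) :: nat \<Rightarrow> nat \<Rightarrow> bool)" by (auto simp: fun_eq_iff)
  then show ?thesis
    by (simp add: represents_list_def list.rel_eq) (metis list_decode_inverse list_encode_inverse)
qed

definition computable ::
    "(nat \<Rightarrow> real) \<Rightarrow> ('a::represented \<Rightarrow> 'b::represented) \<Rightarrow> bool" where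
  "computable \<nu> f \<longleftrightarrow>
     (\<exists>g. rec_unary g \<and> (\<forall>n x. represents \<nu> n x \<longrightarrow> represents \<nu> (g n) (f x)))"

named_theorems computable_intros

lemma computableI:
  "rec_unary g \<Longrightarrow> (\<And>n x. represents \<nu> n x \<Longrightarrow> represents \<nu> (g n) (f x)) \<Longrightarrow> computable \<nu> f"
  unfolding computable_def by blast

lemma computableE:
  assumes "computable \<nu> f"
  obtains g where "rec_unary g" "\<And>n x. represents \<nu> n x \<Longrightarrow> represents \<nu> (g n) (f x)"
  using assms unfolding computable_def by blast

lemma computable_nat_iff: "computable \<nu> (f :: nat \<Rightarrow> nat) \<longleftrightarrow> rec_unary f"
  unfolding computable_def by (auto simp flip: fun_eq_iff)

section \<open>Closure properties: pairs, numbers, truth values\<close>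

lemma computable_comp:
  assumes "computable \<nu> f" "computable \<nu> g"
  shows "computable \<nu> (\<lambda>x. f (g x))"
proof -
  obtain f' g' where *: "rec_unary f'" "\<And>n x. represents \<nu> n x \<Longrightarrow> represents \<nu> (f' n) (f x)"
     "rec_unary g'" "\<And>n x. represents \<nu> n x \<Longrightarrow> represents \<nu> (g' n) (g x)"
    using assms by (metis computableE)
  show ?thesis by (rule computableI[OF rec_unary_comp[OF *(1,3)]]) (use * in blast)
qed

lemma computable_id [computable_intros]: "computable \<nu> (\<lambda>x. x)"
  by (rule computableI[OF rec_unary_id])

lemma computable_const: "represents \<nu> k c \<Longrightarrow> computable \<nu> (\<lambda>_. c)"
  by (rule computableI[OF rec_unary_const])

lemma computable_const_nat [computable_intros]: "computable \<nu> (\<lambda>_. k :: nat)"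
  by (rule computable_const) simp

lemma computable_const_bool [computable_intros]: "computable \<nu> (\<lambda>_. b :: bool)"
  by (rule computable_const) simp

lemma computable_Nil [computable_intros]: "computable \<nu> (\<lambda>_. [] :: 'a::represented list)"
  by (rule computable_const[of _ 0]) (simp add: represents_list_def)

lemma computable_Pair [computable_intros]:
  assumes "computable \<nu> f" "computable \<nu> g"
  shows "computable \<nu> (\<lambda>x. (f x, g x))"
proof -
  obtain f' g' where *: "rec_unary f'" "\<And>n x. represents \<nu> n x \<Longrightarrow> represents \<nu> (f' n) (f x)"
     "rec_unary g'" "\<And>n x. represents \<nu> n x \<Longrightarrow> represents \<nu> (g' n) (g x)"
    using assms by (metis computableE)
  show ?thesis by (rule computableI[OF rec_unary_pair[OF *(1,3)]]) (use * in simp)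
qed

lemma computable_fst [computable_intros]: "computable \<nu> f \<Longrightarrow> computable \<nu> (\<lambda>x. fst (f x))"
  by (rule computable_comp[of _ fst], rule computableI[OF rec_unary_fst[OF rec_unary_id]])
    (auto simp: represents_prod_def)

lemma computable_snd [computable_intros]: "computable \<nu> f \<Longrightarrow> computable \<nu> (\<lambda>x. snd (f x))"
  by (rule computable_comp[of _ snd], rule computableI[OF rec_unary_snd[OF rec_unary_id]])
    (auto simp: represents_prod_def)

lemma computable_comp2:
  assumes "computable \<nu> (\<lambda>p. h (fst p) (snd p))" "computable \<nu> f" "computable \<nu> g"
  shows "computable \<nu> (\<lambda>x. h (f x) (g x))"
  using computable_comp[OF assms(1) computable_Pair[OF assms(2,3)]] by simp

lemma computable_comp3:
  assumes "computable \<nu> (\<lambda>p. h (fst p) (fst (snd p)) (snd (snd p)))"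
    "computable \<nu> f" "computable \<nu> g" "computable \<nu> k"
  shows "computable \<nu> (\<lambda>x. h (f x) (g x) (k x))"
  using computable_comp[OF assms(1) computable_Pair[OF assms(2) computable_Pair[OF assms(3,4)]]]
  by simp

text \<open>The tracking function is the identity: a number, read as the code of a pair, is the code
  of its own decoding. The next three rules rest on the same observation.\<close>

lemma computable_prod_decode [computable_intros]:
  "computable \<nu> f \<Longrightarrow> computable \<nu> (\<lambda>x. prod_decode (f x))"
  by (rule computable_comp[of _ prod_decode], rule computableI[OF rec_unary_id])
    (auto simp: represents_prod_def)

lemma computable_prod_encode [computable_intros]:
  "computable \<nu> f \<Longrightarrow> computable \<nu> (\<lambda>x. prod_encode (f x))"
  by (rule computable_comp[of _ prod_encode], rule computableI[OF rec_unary_id])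
    (auto simp: represents_prod_def)

lemma computable_list_decode [computable_intros]:
  "computable \<nu> f \<Longrightarrow> computable \<nu> (\<lambda>x. list_decode (f x))"
  by (rule computable_comp[of _ list_decode], rule computableI[OF rec_unary_id]) auto

lemma computable_list_encode [computable_intros]:
  "computable \<nu> f \<Longrightarrow> computable \<nu> (\<lambda>x. list_encode (f x))"
  by (rule computable_comp[of _ list_encode], rule computableI[OF rec_unary_id]) auto

lemma computable_Suc [computable_intros]:
  "computable \<nu> f \<Longrightarrow> computable \<nu> (\<lambda>x. Suc (f x))"
  by (rule computable_comp[of _ Suc]) (simp_all add: computable_nat_iff rec_unary_Suc rec_unary_id)

lemma computable_nat_op:
  assumes "rec_unary (\<lambda>n. h (fst (prod_decode n)) (snd (prod_decode n)))"
    "computable \<nu> f" "computable \<nu> g"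
  shows "computable \<nu> (\<lambda>x. h (f x) (g x) :: nat)"
  by (rule computable_comp2[OF _ assms(2,3)], rule computableI[OF assms(1)])
    (auto simp: represents_prod_def)

lemma computable_add [computable_intros]:
  "computable \<nu> f \<Longrightarrow> computable \<nu> g \<Longrightarrow> computable \<nu> (\<lambda>x. f x + g x :: nat)"
  by (rule computable_nat_op) (intro rec_unary_add rec_unary_fst rec_unary_snd rec_unary_id)

lemma computable_mult [computable_intros]:
  "computable \<nu> f \<Longrightarrow> computable \<nu> g \<Longrightarrow> computable \<nu> (\<lambda>x. f x * g x :: nat)"
  by (rule computable_nat_op) (intro rec_unary_mult rec_unary_fst rec_unary_snd rec_unary_id)

lemma computable_le [computable_intros]:
  assumes "computable \<nu> f" "computable \<nu> g"
  shows "computable \<nu> (\<lambda>x. f x \<le> (g x :: nat))"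
  by (rule computable_comp2[OF _ assms], rule computableI[OF rec_unary_le[OF
     rec_unary_fst[OF rec_unary_id] rec_unary_snd[OF rec_unary_id]]])
    (auto simp: represents_prod_def)

text \<open>The step may depend on the parameter \<open>x\<close>, so it is required to be
  computable as one function of parameter, counter and accumulator. The codes are followed along the
  recursion by induction on the counter.\<close>

lemma computable_rec_nat [computable_intros]:
  assumes "computable \<nu> f"
    "computable \<nu> (\<lambda>p. g (fst p) (fst (snd p)) (snd (snd p)))"
    "computable \<nu> j"
  shows "computable \<nu> (\<lambda>x. rec_nat (f x) (g x) (j x))"
proof -
  obtain f' where f': "rec_unary f'" "\<And>n x. represents \<nu> n x \<Longrightarrow> represents \<nu> (f' n) (f x)"
    by (rule computableE[OF assms(1)]) blast
  obtain g' where g': "rec_unary g'"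
    "\<And>n p. represents \<nu> n p \<Longrightarrow> represents \<nu> (g' n) (g (fst p) (fst (snd p)) (snd (snd p)))"
    by (rule computableE[OF assms(2)]) blast
  obtain j' where j': "rec_unary j'" "\<And>n x. represents \<nu> n x \<Longrightarrow> represents \<nu> (j' n) (j x)"
    by (rule computableE[OF assms(3)]) blast
  show ?thesis
  proof (rule computableI[OF rec_unary_rec_nat[OF f'(1) g'(1) j'(1)]])
    fix n and x :: 'a
    assume n: "represents \<nu> n x"
    have "represents \<nu> (rec_nat (f' n) (\<lambda>k r. g' (prod_encode (n, prod_encode (k, r)))) i)
        (rec_nat (f x) (g x) i)" for i
    proof (induction i)
      case (Suc i)
      then show ?case
        using n g'(2)[of _ "(x, i, _)"] by simp
    qed (use f' n in simp)
    then show "represents \<nu> (rec_nat (f' n) (\<lambda>k r. g' (prod_encode (n, prod_encode (k, r)))) (j' n))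
        (rec_nat (f x) (g x) (j x))"
      using j'(2)[OF n] by simp
  qed
qed

lemma computable_of_bool [computable_intros]:
  "computable \<nu> f \<Longrightarrow> computable \<nu> (\<lambda>x. of_bool (f x) :: nat)"
  by (rule computable_comp[of _ of_bool], rule computableI[OF rec_unary_id]) auto

text \<open>A case distinction is a recursion run for 0 or 1 rounds whose step ignores the
  accumulator. Tracking functions are total, so evaluating both branches does no harm.\<close>

lemma computable_If [computable_intros]:
  assumes "computable \<nu> b" "computable \<nu> f" "computable \<nu> g"
  shows "computable \<nu> (\<lambda>x. if b x then f x else g x)"
proof -
  have "computable \<nu> (\<lambda>x. rec_nat (g x) (\<lambda>_ _. f x) (of_bool (b x)))"
    by (intro computable_intros assms computable_comp[OF assms(2)])
  moreover have "rec_nat (g x) (\<lambda>_ _. f x) (of_bool (b x)) = (if b x then f x else g x)" for x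
    by simp
  ultimately show ?thesis by simp
qed

lemma computable_not [computable_intros]:
  assumes "computable \<nu> b" shows "computable \<nu> (\<lambda>x. \<not> b x)"
  using computable_If[OF assms computable_const_bool[of _ False] computable_const_bool[of _ True]]
  by (rule back_subst[of "computable \<nu>"]) auto

lemma computable_conj [computable_intros]:
  assumes "computable \<nu> a" "computable \<nu> b" shows "computable \<nu> (\<lambda>x. a x \<and> b x)"
  using computable_If[OF assms computable_const_bool[of _ False]]
  by (rule back_subst[of "computable \<nu>"]) auto

lemma computable_disj [computable_intros]:
  assumes "computable \<nu> a" "computable \<nu> b" shows "computable \<nu> (\<lambda>x. a x \<or> b x)"
  using computable_If[OF assms(1) computable_const_bool[of _ True] assms(2)]
  by (rule back_subst[of "computable \<nu>"]) auto

lemma computable_eq [computable_intros]: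
  assumes "computable \<nu> f" "computable \<nu> g"
  shows "computable \<nu> (\<lambda>x. f x = (g x :: nat))"
  using computable_conj[OF computable_le[OF assms] computable_le[OF assms(2,1)]]
  by (simp add: eq_iff)

section \<open>Lists\<close>

lemma computable_Cons [computable_intros]:
  assumes "computable \<nu> f" "computable \<nu> g"
  shows "computable \<nu> (\<lambda>x. f x # g x)"
  by (rule computable_comp2[OF _ assms], rule computableI[OF rec_unary_Suc[OF rec_unary_id]])
    (auto simp: represents_prod_def represents_list_def split: prod.split)

text \<open>On the empty list, coded by 0, the tracking functions of \<open>tl\<close> and
  \<open>head0\<close> take the predecessor 0 and decode it; both components are then 0, the code of
  \<open>[]\<close> and the default head.\<close>

lemma prod_decode_0: "prod_decode 0 = (0, 0)"
  by (metis prod_encode_inverse le_prod_encode_1 le_prod_encode_2 le_zero_eq prod_decode_inverse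
    surj_pair)

lemma computable_tl [computable_intros]:
  assumes "computable \<nu> f"
  shows "computable \<nu> (\<lambda>x. tl (f x))"
proof (rule computable_comp[OF _ assms], rule computableI)
  show "rec_unary (\<lambda>n. snd (prod_decode (n - 1)))"
    by (intro rec_unary_snd rec_unary_pred rec_unary_id)
  fix n and xs :: "'b list"
  assume "represents \<nu> n xs"
  then show "represents \<nu> (snd (prod_decode (n - 1))) (tl xs)"
    by (cases n)
      (auto simp: represents_list_def prod_decode_0 list_all2_Cons1 split: prod.splits)
qed

text \<open>\<open>hd []\<close> is an unspecified number, whereas decoding yields 0 there; the
  default makes the two agree.\<close>

definition head0 :: "nat list \<Rightarrow> nat" where
  "head0 xs = (if xs = [] then 0 else hd xs)"

lemma head0_Cons [simp]: "head0 (x # xs) = x"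
  by (simp add: head0_def)

lemma computable_head0 [computable_intros]:
  assumes "computable \<nu> f"
  shows "computable \<nu> (\<lambda>x. head0 (f x))"
proof (rule computable_comp[OF _ assms], rule computableI)
  show "rec_unary (\<lambda>n. fst (prod_decode (n - 1)))"
    by (intro rec_unary_fst rec_unary_pred rec_unary_id)
  fix n and xs :: "nat list"
  assume "represents \<nu> n xs"
  then show "represents \<nu> (fst (prod_decode (n - 1))) (head0 xs)"
    by (cases xs) (auto simp: head0_def prod_decode_0)
qed

lemma computable_nat_list_eq_Nil [computable_intros]:
  assumes "computable \<nu> f"
  shows "computable \<nu> (\<lambda>x. f x = ([] :: nat list))"
proof -
  note computable_eq[OF computable_list_encode[OF assms] computable_const_nat[of _ 0]]
  then show ?thesis
    by (rule back_subst[of "computable \<nu>"]) (metis list_encode.simps(1) list_encode_eq)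
qed

lemma computable_drop [computable_intros]:
  assumes "computable \<nu> k" "computable \<nu> f"
  shows "computable \<nu> (\<lambda>x. drop (k x) (f x))"
proof -
  have "rec_nat xs (\<lambda>_. tl) n = drop n xs" for xs :: "'b list" and n
    by (induction n) (auto simp: drop_Suc tl_drop)
  moreover have "computable \<nu> (\<lambda>x. rec_nat (f x) (\<lambda>_. tl) (k x))"
    by (intro computable_intros assms)
  ultimately show ?thesis by simp
qed

text \<open>Gives a bound on the number of rounds of a fold that is available before any list
  recursion is: the code itself.\<close>

lemma length_le_list_encode: "length xs \<le> list_encode xs"
  by (induction xs) (auto intro: order_trans[OF _ le_prod_encode_2])

text \<open>Folding is first done on lists of numbers, because a head with a default value exists
  only there; an arbitrary represented type offers no default. The state consumes the list while the
  accumulator grows.\<close>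

lemma computable_foldl_code:
  assumes "rec_unary g"
  shows "computable \<nu> (\<lambda>p. foldl (\<lambda>b a. g (prod_encode (fst p, prod_encode (b, a))))
     (fst (snd p)) (snd (snd p)))"
proof -
  define step where "step c s = (if fst s = [] then s else
     (tl (fst s), g (prod_encode (c, prod_encode (snd s, head0 (fst s))))))" for c s
  have g: "computable \<nu> g"
    using assms by (simp add: computable_nat_iff)
  \<comment> \<open>\<open>step\<close> is stationary once the list is exhausted, so every number of
    rounds from the length on gives the fold.\<close>
  have iter: "rec_nat (xs, b) (\<lambda>_. step c) n =
      ([], foldl (\<lambda>b a. g (prod_encode (c, prod_encode (b, a)))) b xs)"
    if "length xs \<le> n" for xs b n c
    using that
  proof (induction n arbitrary: xs b)
    case (Suc n)
    have shift: "rec_nat s (\<lambda>_. step c) (Suc n) = rec_nat (step c s) (\<lambda>_. step c) n" for s n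
      by (induction n) auto
    have "step c (x # l, b) = (l, g (prod_encode (c, prod_encode (b, x))))" "step c ([], b) = ([], b)"
      for x l b by (simp_all add: step_def)
    then show ?case
      unfolding shift using Suc by (cases xs) auto
  qed simp
  have "computable \<nu> (\<lambda>p. snd (rec_nat (snd (snd p), fst (snd p))
      (\<lambda>_. step (fst p)) (list_encode (snd (snd p)))))"
    unfolding step_def
    by (intro computable_intros computable_comp[OF g])
  then show ?thesis
    by (simp add: iter length_le_list_encode)
qed

text \<open>Transfers the fold on codes to represented elements: the accumulated code keeps
  representing the accumulated value.\<close>

lemma computable_foldl [computable_intros]:
  assumes "computable \<nu> (\<lambda>p. step (fst p) (fst (snd p)) (snd (snd p)))"
    "computable \<nu> f" "computable \<nu> xs"
  shows "computable \<nu> (\<lambda>x. foldl (step x) (f x) (xs x))"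
proof -
  obtain g where g: "rec_unary g" "\<And>n p. represents \<nu> n p \<Longrightarrow>
      represents \<nu> (g n) (step (fst p) (fst (snd p)) (snd (snd p)))"
    by (rule computableE[OF assms(1)]) blast
  obtain h where h: "rec_unary h" "\<And>n p. represents \<nu> n p \<Longrightarrow> represents \<nu> (h n)
      (foldl (\<lambda>b a. g (prod_encode (fst p, prod_encode (b, a)))) (fst (snd p)) (snd (snd p)))"
    by (rule computableE[OF computable_foldl_code[OF g(1)]]) blast
  have "computable \<nu> (\<lambda>p. foldl (step (fst p)) (fst (snd p)) (snd (snd p)))"
  proof (rule computableI[OF h(1)])
    fix n and p :: "'a \<times> 'b \<times> 'c list"
    assume p: "represents \<nu> n p"
    obtain c b l where n: "n = prod_encode (c, prod_encode (b, list_encode l))"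
      by (metis prod_decode_inverse list_decode_inverse surj_pair)
    obtain x y ys where p_eq: "p = (x, y, ys)" by (metis surj_pair)
    have hn: "h n = foldl (\<lambda>b a. g (prod_encode (c, prod_encode (b, a)))) b l"
      using h(2)[of n "(c, b, l)"] n by simp
    have x: "represents \<nu> c x" and y: "represents \<nu> b y" and ys: "list_all2 (represents \<nu>) l ys"
      using p by (auto simp: n p_eq)
    have "represents \<nu> (foldl (\<lambda>b a. g (prod_encode (c, prod_encode (b, a)))) b l)
       (foldl (step x) y ys)"
      using ys y
    proof (induction arbitrary: b y rule: list_all2_induct)
      case (Cons a as z zs)
      have "represents \<nu> (g (prod_encode (c, prod_encode (b, a)))) (step x y z)"
        using g(2)[of _ "(x, y, z)"] x Cons by simp
      then show ?case using Cons by simp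
    qed simp
    then show "represents \<nu> (h n) (foldl (step (fst p)) (fst (snd p)) (snd (snd p)))"
      by (simp add: hn p_eq)
  qed
  from computable_comp[OF this computable_Pair[OF computable_id computable_Pair[OF assms(2,3)]]]
  show ?thesis by simp
qed

lemma computable_rev [computable_intros]:
  assumes "computable \<nu> f" shows "computable \<nu> (\<lambda>x. rev (f x))"
proof -
  have "foldl (\<lambda>b a. a # b) ys xs = rev xs @ ys" for xs ys :: "'b list"
    by (induction xs arbitrary: ys) auto
  then have "rev xs = foldl (\<lambda>b a. a # b) [] xs" for xs :: "'b list" by simp
  then show ?thesis by (simp only:) (intro computable_intros assms)
qed

lemma computable_foldr [computable_intros]:
  assumes "computable \<nu> (\<lambda>p. step (fst p) (fst (snd p)) (snd (snd p)))"
    "computable \<nu> xs" "computable \<nu> f"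
  shows "computable \<nu> (\<lambda>x. foldr (step x) (xs x) (f x))"
  unfolding foldr_conv_foldl
  by (intro computable_intros assms(2,3) computable_comp3[where h = step, OF assms(1)])

lemma computable_append [computable_intros]:
  assumes "computable \<nu> f" "computable \<nu> g" shows "computable \<nu> (\<lambda>x. f x @ g x)"
proof -
  have "xs @ ys = foldr (#) xs ys" for xs ys :: "'b list" by (induction xs) auto
  then show ?thesis by (simp only:) (intro computable_intros assms)
qed

lemma computable_concat [computable_intros]:
  assumes "computable \<nu> f" shows "computable \<nu> (\<lambda>x. concat (f x))"
  unfolding concat_conv_foldr by (intro computable_intros assms)

lemma computable_map [computable_intros]:
  assumes "computable \<nu> (\<lambda>p. h (fst p) (snd p))" "computable \<nu> f"
  shows "computable \<nu> (\<lambda>x. map (h x) (f x))"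
proof -
  have "map h xs = foldr (\<lambda>a b. h a # b) xs []" for h :: "'b \<Rightarrow> 'c" and xs
    by (induction xs) auto
  then show ?thesis
    by (simp only:) (intro computable_intros assms(2) computable_comp2[where h = h, OF assms(1)])
qed

lemma computable_filter [computable_intros]:
  assumes "computable \<nu> (\<lambda>p. h (fst p) (snd p))" "computable \<nu> f"
  shows "computable \<nu> (\<lambda>x. filter (h x) (f x))"
proof -
  have "filter h xs = foldr (\<lambda>a b. if h a then a # b else b) xs []" for h :: "'b \<Rightarrow> bool" and xs
    by (induction xs) auto
  then show ?thesis
    by (simp only:) (intro computable_intros assms(2) computable_comp2[where h = h, OF assms(1)])
qed

lemma computable_list_ex [computable_intros]:
  assumes "computable \<nu> (\<lambda>p. h (fst p) (snd p))" "computable \<nu> f"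
  shows "computable \<nu> (\<lambda>x. list_ex (h x) (f x))"
proof -
  have "list_ex h xs = foldr (\<lambda>a b. h a \<or> b) xs False" for h :: "'b \<Rightarrow> bool" and xs
    by (induction xs) auto
  then show ?thesis
    by (simp only:) (intro computable_intros assms(2) computable_comp2[where h = h, OF assms(1)])
qed

lemma computable_list_all [computable_intros]:
  assumes "computable \<nu> (\<lambda>p. h (fst p) (snd p))" "computable \<nu> f"
  shows "computable \<nu> (\<lambda>x. list_all (h x) (f x))"
proof -
  have "list_all h xs = foldr (\<lambda>a b. h a \<and> b) xs True" for h :: "'b \<Rightarrow> bool" and xs
    by (induction xs) auto
  then show ?thesis
    by (simp only:) (intro computable_intros assms(2) computable_comp2[where h = h, OF assms(1)])
qed

text \<open>Given by start and length, so that it is a recursion on the length and adjacent segments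
  append without side conditions.\<close>

definition segment :: "nat \<Rightarrow> nat \<Rightarrow> nat list" where
  "segment a n = [a..<a + n]"

lemma computable_segment [computable_intros]:
  assumes "computable \<nu> f" "computable \<nu> g"
  shows "computable \<nu> (\<lambda>x. segment (f x) (g x))"
proof -
  have "segment a n = rec_nat [] (\<lambda>k r. r @ [a + k]) n" for a n
    by (induction n) (auto simp: segment_def)
  then show ?thesis
    by (simp only:) (intro computable_intros assms computable_comp[OF assms(1)])
qed

lemma computable_sum_list [computable_intros]:
  assumes "computable \<nu> f" shows "computable \<nu> (\<lambda>x. sum_list (f x) :: nat)"
  unfolding sum_list.eq_foldr by (intro computable_intros assms)

text \<open>The first list is folded while the second is consumed in the state by
  \<open>head0\<close>, hence the restriction of the second list to numbers, which are variable
  indices in the application.\<close>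

lemma computable_zip [computable_intros]:
  assumes "computable \<nu> f" "computable \<nu> g"
  shows "computable \<nu> (\<lambda>x. zip (f x) (g x :: nat list))"
proof -
  have "snd (foldl (\<lambda>s a. (tl (fst s), if fst s = [] then snd s else snd s @ [(a, head0 (fst s))]))
      (ys, zs) xs) = zs @ zip xs ys" for xs :: "'b list" and ys zs
    by (induction xs arbitrary: ys zs) (auto split: list.split simp: zip_Cons1)
  then have "zip xs ys = snd (foldl (\<lambda>s a. (tl (fst s), if fst s = [] then snd s
      else snd s @ [(a, head0 (fst s))])) (ys, []) xs)" for xs :: "'b list" and ys
    by simp
  then show ?thesis
    by (simp only:) (intro computable_intros assms)
qed

section \<open>Recursion over codes of syntax trees\<close>

text \<open>Primitive recursion builds the table of all earlier values; the value at
  \<open>n\<close> is then \<open>G\<close> applied to the table of length \<open>n\<close>.\<close>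

lemma course_of_values_recursion:
  assumes "computable \<nu> (G :: nat \<times> nat \<times> nat list \<Rightarrow> nat)"
  obtains T where "computable \<nu> T" "\<And>c n. T (c, n) = G (c, n, map (\<lambda>i. T (c, i)) [0..<n])"
proof -
  define table where "table c n = rec_nat [] (\<lambda>k tb. tb @ [G (c, k, tb)]) n" for c n
  define T where "T p = G (fst p, snd p, table (fst p) (snd p))" for p
  have "computable \<nu> T"
    unfolding T_def table_def by (intro computable_intros computable_comp[OF assms])
  moreover have "table c n = map (\<lambda>i. T (c, i)) [0..<n]" for c n
    by (induction n) (simp_all add: table_def T_def)
  then have "T (c, n) = G (c, n, map (\<lambda>i. T (c, i)) [0..<n])" for c n
    by (subst T_def) simp
  ultimately show thesis by (rule that)
qed

lemma head0_drop: "i < length xs \<Longrightarrow> head0 (drop i xs) = xs ! i"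
  by (simp add: head0_def hd_drop_conv_nth)

text \<open>Makes the payload a legitimate index for recursion. For tag 0 this fails:
  \<open>prod_encode (0, n)\<close> is \<open>triangle n\<close>, which equals \<open>n\<close> for
  \<open>n\<close> = 0 and \<open>n\<close> = 1.\<close>

lemma prod_encode_less: "0 < k \<Longrightarrow> n < prod_encode (k, n)"
proof -
  have "i \<le> triangle i" for i by (induction i) auto
  from this[of "k + n"] show "0 < k \<Longrightarrow> n < prod_encode (k, n)"
    by (simp add: prod_encode_def)
qed

text \<open>
  Recursion over codes of the form \<open>\<langle>tag, payload\<rangle>\<close>, with access to the values at the payload and, if
  the payload is itself a pair, at its components.  The tag \<open>0\<close> is reserved for leaves.
\<close>

lemma tree_recursion:
  assumes "computable \<nu> (G :: nat \<times> nat \<times> nat \<times> nat \<times> nat \<times> nat \<Rightarrow> nat)"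
  obtains T where "computable \<nu> T"
    "\<And>c q. \<exists>v. T (c, prod_encode (0, q)) = G (c, 0, q, v)"
    "\<And>c k q. 0 < k \<Longrightarrow> T (c, prod_encode (k, q)) =
       G (c, k, q, T (c, q), T (c, fst (prod_decode q)), T (c, snd (prod_decode q)))"
proof -
  define H where "H p =
    (let q = snd (prod_decode (fst (snd p))); tb = snd (snd p) in
      G (fst p, fst (prod_decode (fst (snd p))), q, head0 (drop q tb),
         head0 (drop (fst (prod_decode q)) tb), head0 (drop (snd (prod_decode q)) tb)))" for p
  have "computable \<nu> H"
    unfolding H_def Let_def by (intro computable_intros computable_comp[OF assms])
  then obtain T where T: "computable \<nu> T"
    "\<And>c n. T (c, n) = H (c, n, map (\<lambda>i. T (c, i)) [0..<n])"
    by (rule course_of_values_recursion) blast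
  have look: "head0 (drop i (map (\<lambda>i. T (c, i)) [0..<n])) = T (c, i)" if "i < n" for c i n
    using that by (subst head0_drop) auto
  show thesis
  proof (rule that[OF T(1)])
    \<comment> \<open>Under tag 0 the look-ups may lie outside the table, so nothing is claimed
      about the values \<open>v\<close> they return.\<close>
    show "\<exists>v. T (c, prod_encode (0, q)) = G (c, 0, q, v)" for c q
      by (subst T(2)) (auto simp: H_def Let_def)
    fix c k q :: nat
    assume k: "0 < k"
    have q: "q < prod_encode (k, q)" using k by (rule prod_encode_less)
    have "fst (prod_decode q) \<le> q" "snd (prod_decode q) \<le> q"
      by (metis le_prod_encode_1 prod.collapse prod_decode_inverse,
          metis le_prod_encode_2 prod.collapse prod_decode_inverse)
    then have less: "fst (prod_decode q) < prod_encode (k, q)" "snd (prod_decode q) < prod_encode (k, q)"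
      using q by auto
    show "T (c, prod_encode (k, q)) =
       G (c, k, q, T (c, q), T (c, fst (prod_decode q)), T (c, snd (prod_decode q)))"
      by (subst T(2)) (simp add: H_def Let_def look[OF q] look[OF less(1)] look[OF less(2)])
  qed
qed

lemma represents_rat_list:
  "represents \<nu> (list_encode (map rat_encode cs)) cs"
  by (simp add: list.rel_map list.rel_refl)

text \<open>Any function defined by structural recursion on \<open>lin\<close> is computable if its
  four clauses are: a code of a formula is a tagged tree, so the clauses can be run on codes by
  \<open>tree_recursion\<close>.\<close>

lemma computable_lin_rec:
  assumes "computable \<nu> (\<lambda>p. le (fst p) (fst (snd p)) (snd (snd p)))"
    and "computable \<nu> (\<lambda>p. ls (fst p) (fst (snd p)) (snd (snd p)))"
    and "computable \<nu> (\<lambda>p. and' (fst p) (fst (snd p)) (snd (snd p)))"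
    and "computable \<nu> (\<lambda>p. or' (fst p) (fst (snd p)) (snd (snd p)))"
    and F: "\<And>x cs d. F x (Le cs d) = le x cs d" "\<And>x cs d. F x (Less cs d) = ls x cs d"
      "\<And>x p q. F x (And p q) = and' x (F x p) (F x q)"
      "\<And>x p q. F x (Or p q) = or' x (F x p) (F x q)"
  shows "computable \<nu> (\<lambda>p. F (fst p) (snd p))"
proof -
  obtain le' where le': "rec_unary le'" "\<And>n p. represents \<nu> n p \<Longrightarrow>
      represents \<nu> (le' n) (le (fst p) (fst (snd p)) (snd (snd p)))"
    by (rule computableE[OF assms(1)]) blast
  obtain less' where less': "rec_unary less'" "\<And>n p. represents \<nu> n p \<Longrightarrow>
      represents \<nu> (less' n) (ls (fst p) (fst (snd p)) (snd (snd p)))"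
    by (rule computableE[OF assms(2)]) blast
  obtain an where an: "rec_unary an" "\<And>n p. represents \<nu> n p \<Longrightarrow>
      represents \<nu> (an n) (and' (fst p) (fst (snd p)) (snd (snd p)))"
    by (rule computableE[OF assms(3)]) blast
  obtain od where od: "rec_unary od" "\<And>n p. represents \<nu> n p \<Longrightarrow>
      represents \<nu> (od n) (or' (fst p) (fst (snd p)) (snd (snd p)))"
    by (rule computableE[OF assms(4)]) blast
  \<comment> \<open>The six components are the parameter, the tag, the payload, the value at the
    payload and the values at its two halves. The binary connectives use the last two, the leaves
    use the payload itself.\<close>
  define G where "G = (\<lambda>p :: nat \<times> nat \<times> nat \<times> nat \<times> nat \<times> nat.
    if fst (snd p) = 0 then le' (prod_encode (fst p, fst (snd (snd p))))
    else if fst (snd p) = 1 then less' (prod_encode (fst p, fst (snd (snd p))))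
    else if fst (snd p) = 2 then an (prod_encode (fst p, prod_encode (snd (snd (snd (snd p))))))
    else od (prod_encode (fst p, prod_encode (snd (snd (snd (snd p)))))))"
  note code = computable_nat_iff[of \<nu>]
  have "computable \<nu> G"
    unfolding G_def
    by (intro computable_intros computable_comp[OF le'(1)[folded code]]
      computable_comp[OF less'(1)[folded code]]
      computable_comp[OF an(1)[folded code]] computable_comp[OF od(1)[folded code]])
  then obtain T where T: "computable \<nu> T"
    "\<And>c q. \<exists>v. T (c, prod_encode (0, q)) = G (c, 0, q, v)"
    "\<And>c k q. 0 < k \<Longrightarrow> T (c, prod_encode (k, q)) =
       G (c, k, q, T (c, q), T (c, fst (prod_decode q)), T (c, snd (prod_decode q)))"
    by (rule tree_recursion) blast
  have main: "represents \<nu> (T (c, lin_encode p)) (F x p)" if c: "represents \<nu> c x" for c x p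
  proof (induction p)
    case (Le cs d)
    obtain v where "T (c, lin_encode (Le cs d)) =
        G (c, 0, prod_encode (list_encode (map rat_encode cs), rat_encode d), v)"
      using T(2) unfolding lin_encode.simps by blast
    then show ?case
      using le'(2)[of _ "(x, cs, d)"] c
      by (simp add: G_def F represents_rat_list del: represents_list_encode)
  next
    case (Less cs d)
    then show ?case
      using less'(2)[of _ "(x, cs, d)"] c
      by (simp add: T(3) G_def F represents_rat_list del: represents_list_encode)
  next
    case (And p q)
    then show ?case using an(2)[of _ "(x, F x p, F x q)"] c by (simp add: T(3) G_def F)
  next
    case (Or p q)
    then show ?case using od(2)[of _ "(x, F x p, F x q)"] c by (simp add: T(3) G_def F)
  qed
  show ?thesis
  proof (rule computableI)
    show "rec_unary (\<lambda>n. T (prod_decode n))"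
      unfolding computable_nat_iff[symmetric, of _ \<nu>]
      by (intro computable_intros computable_comp[OF T(1)])
    fix n and p :: "'a \<times> lin"
    assume "represents \<nu> n p"
    then show "represents \<nu> (T (prod_decode n)) (F (fst p) (snd p))"
      using main[of "fst (prod_decode n)" "fst p" "snd p"]
      by (cases "prod_decode n") (simp add: represents_prod_def)
  qed
qed

text \<open>A formula arrives as a tree over names, while \<open>F\<close> runs on its
  interpretation over the reals; hence the conclusion relates the code of \<phi> to the value at
  \<open>map_ltl \<nu> \<phi>\<close>. The last branch of \<open>G\<close> also catches the tags of
  the unbounded operators, which boundedness excludes.\<close>

lemma computable_bounded_ltl_rec:
  assumes "computable \<nu> (\<lambda>p. atom (fst p) (fst (snd p)) (snd (snd p)))"
    and "computable \<nu> (\<lambda>p. neg (fst p) (snd p))"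
    and "computable \<nu> (\<lambda>p. and' (fst p) (fst (snd p)) (snd (snd p)))"
    and "computable \<nu> (\<lambda>p. or' (fst p) (fst (snd p)) (snd (snd p)))"
    and "computable \<nu> (\<lambda>p. next' (fst p) (snd p))"
    and F: "\<And>x cs d. F x (Atom cs d) = atom x cs d" "\<And>x p. F x (Neg p) = neg x (F x p)"
      "\<And>x p q. F x (Conj p q) = and' x (F x p) (F x q)"
      "\<And>x p q. F x (Disj p q) = or' x (F x p) (F x q)"
      "\<And>x p. F x (Next p) = next' x (F x p)"
  obtains T where "computable \<nu> T"
    "\<And>c x \<phi>. represents \<nu> c x \<Longrightarrow> bounded_ltl \<phi> \<Longrightarrow>
       represents \<nu> (T (c, ltl_encode \<phi>)) (F x (map_ltl \<nu> \<phi>))"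
proof -
  obtain at' where at': "rec_unary at'" "\<And>n p. represents \<nu> n p \<Longrightarrow>
      represents \<nu> (at' n) (atom (fst p) (fst (snd p)) (snd (snd p)))"
    by (rule computableE[OF assms(1)]) blast
  obtain ng where ng: "rec_unary ng" "\<And>n p. represents \<nu> n p \<Longrightarrow>
      represents \<nu> (ng n) (neg (fst p) (snd p))"
    by (rule computableE[OF assms(2)]) blast
  obtain an where an: "rec_unary an" "\<And>n p. represents \<nu> n p \<Longrightarrow>
      represents \<nu> (an n) (and' (fst p) (fst (snd p)) (snd (snd p)))"
    by (rule computableE[OF assms(3)]) blast
  obtain od where od: "rec_unary od" "\<And>n p. represents \<nu> n p \<Longrightarrow>
      represents \<nu> (od n) (or' (fst p) (fst (snd p)) (snd (snd p)))"
    by (rule computableE[OF assms(4)]) blast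
  obtain nx where nx: "rec_unary nx" "\<And>n p. represents \<nu> n p \<Longrightarrow>
      represents \<nu> (nx n) (next' (fst p) (snd p))"
    by (rule computableE[OF assms(5)]) blast
  define G where "G = (\<lambda>p :: nat \<times> nat \<times> nat \<times> nat \<times> nat \<times> nat.
    if fst (snd p) = 0 then at' (prod_encode (fst p, fst (snd (snd p))))
    else if fst (snd p) = 1 then ng (prod_encode (fst p, fst (snd (snd (snd p)))))
    else if fst (snd p) = 2 then an (prod_encode (fst p, prod_encode (snd (snd (snd (snd p))))))
    else if fst (snd p) = 3 then od (prod_encode (fst p, prod_encode (snd (snd (snd (snd p))))))
    else nx (prod_encode (fst p, fst (snd (snd (snd p))))))"
  note code = computable_nat_iff[of \<nu>]
  have "computable \<nu> G"
    unfolding G_def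
    by (intro computable_intros computable_comp[OF at'(1)[folded code]]
      computable_comp[OF ng(1)[folded code]]
      computable_comp[OF an(1)[folded code]] computable_comp[OF od(1)[folded code]]
      computable_comp[OF nx(1)[folded code]])
  then obtain T where T: "computable \<nu> T"
    "\<And>c q. \<exists>v. T (c, prod_encode (0, q)) = G (c, 0, q, v)"
    "\<And>c k q. 0 < k \<Longrightarrow> T (c, prod_encode (k, q)) =
       G (c, k, q, T (c, q), T (c, fst (prod_decode q)), T (c, snd (prod_decode q)))"
    by (rule tree_recursion) blast
  have "represents \<nu> (T (c, ltl_encode \<phi>)) (F x (map_ltl \<nu> \<phi>))"
    if c: "represents \<nu> c x" and "bounded_ltl \<phi>" for c x \<phi>
    using that(2)
  proof (induction \<phi>)
    case (Atom cs d)
    obtain v where v: "T (c, ltl_encode (Atom cs d)) =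
        G (c, 0, prod_encode (list_encode cs, d), v)"
      using T(2) unfolding ltl_encode.simps by blast
    have "list_all2 (represents \<nu>) cs (map \<nu> cs)"
      by (simp add: list.rel_map list.rel_refl)
    then show ?case
      using at'(2)[of _ "(x, map \<nu> cs, \<nu> d)"] c v by (simp add: G_def F)
  next
    case (Neg p)
    then show ?case using ng(2)[of _ "(x, F x (map_ltl \<nu> p))"] c by (simp add: T(3) G_def F)
  next
    case (Conj p q)
    then show ?case using an(2)[of _ "(x, F x (map_ltl \<nu> p), F x (map_ltl \<nu> q))"] c
      by (simp add: T(3) G_def F)
  next
    case (Disj p q)
    then show ?case using od(2)[of _ "(x, F x (map_ltl \<nu> p), F x (map_ltl \<nu> q))"] c
      by (simp add: T(3) G_def F)
  next
    case (Next p)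
    then show ?case using nx(2)[of _ "(x, F x (map_ltl \<nu> p))"] c by (simp add: T(3) G_def F)
  qed simp_all
  then show thesis by (rule that[OF T(1)])
qed

section \<open>Arithmetic on named reals\<close>

locale effective_field =
  fixes \<nu> :: "nat \<Rightarrow> real"
  assumes effective: "effective_ordered_field \<nu>"
begin

lemma range_inverse: "inverse (\<nu> a) \<in> range \<nu>"
  using effective unfolding effective_ordered_field_def by blast

lemma range_uminus_one: "- 1 \<in> range \<nu>"
  using effective unfolding effective_ordered_field_def by (metis imageE)

lemma range_one: "1 \<in> range \<nu>"
  using effective unfolding effective_ordered_field_def by blast

lemma range_zero: "0 \<in> range \<nu>"
proof -
  obtain a b where "\<nu> a = 1" "\<nu> b = - 1" using range_one range_uminus_one by (metis imageE)
  moreover obtain f where "\<And>a b. \<nu> (f [a, b]) = \<nu> a + \<nu> b"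
    using effective unfolding effective_ordered_field_def by blast
  ultimately have "\<nu> (f [a, b]) = 0" by simp
  then show ?thesis by (metis rangeI)
qed

lemma computable_real_const: "r \<in> range \<nu> \<Longrightarrow> computable \<nu> (\<lambda>_. r)"
  by (auto intro: computable_const)

lemma computable_real_zero [computable_intros]: "computable \<nu> (\<lambda>_. 0 :: real)"
  by (rule computable_real_const[OF range_zero])

lemma computable_real_one [computable_intros]: "computable \<nu> (\<lambda>_. 1 :: real)"
  by (rule computable_real_const[OF range_one])

lemma computable_real_add [computable_intros]:
  assumes "computable \<nu> f" "computable \<nu> g"
  shows "computable \<nu> (\<lambda>x. f x + g x :: real)"
proof -
  obtain h where h: "recursive_fn 2 h" "\<And>a b. \<nu> (h [a, b]) = \<nu> a + \<nu> b"
    using effective unfolding effective_ordered_field_def by blast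
  show ?thesis
    by (rule computable_comp2[OF _ assms], rule computableI[OF rec_unary_recursive_fn2[OF h(1)
      rec_unary_fst[OF rec_unary_id] rec_unary_snd[OF rec_unary_id]]])
      (simp add: represents_prod_def h(2))
qed

lemma computable_real_mult [computable_intros]:
  assumes "computable \<nu> f" "computable \<nu> g"
  shows "computable \<nu> (\<lambda>x. f x * g x :: real)"
proof -
  obtain h where h: "recursive_fn 2 h" "\<And>a b. \<nu> (h [a, b]) = \<nu> a * \<nu> b"
    using effective unfolding effective_ordered_field_def by blast
  show ?thesis
    by (rule computable_comp2[OF _ assms], rule computableI[OF rec_unary_recursive_fn2[OF h(1)
      rec_unary_fst[OF rec_unary_id] rec_unary_snd[OF rec_unary_id]]])
      (simp add: represents_prod_def h(2))
qed

lemma computable_real_le [computable_intros]: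
  assumes "computable \<nu> f" "computable \<nu> g"
  shows "computable \<nu> (\<lambda>x. f x \<le> (g x :: real))"
proof -
  obtain h where h: "recursive_fn 2 h" "\<And>a b. h [a, b] = (if \<nu> a \<le> \<nu> b then 1 else 0)"
    using effective unfolding effective_ordered_field_def by blast
  show ?thesis
    by (rule computable_comp2[OF _ assms], rule computableI[OF rec_unary_recursive_fn2[OF h(1)
      rec_unary_fst[OF rec_unary_id] rec_unary_snd[OF rec_unary_id]]])
      (simp add: represents_prod_def h(2))
qed

lemma computable_real_less [computable_intros]:
  assumes "computable \<nu> f" "computable \<nu> g"
  shows "computable \<nu> (\<lambda>x. f x < (g x :: real))"
  using computable_not[OF computable_real_le[OF assms(2,1)]] by (simp add: not_le)

lemma computable_real_eq [computable_intros]: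
  assumes "computable \<nu> f" "computable \<nu> g"
  shows "computable \<nu> (\<lambda>x. f x = (g x :: real))"
  using computable_conj[OF computable_real_le[OF assms] computable_real_le[OF assms(2,1)]]
  by (simp add: eq_iff)

lemma computable_real_uminus [computable_intros]:
  assumes "computable \<nu> f" shows "computable \<nu> (\<lambda>x. - f x :: real)"
  using computable_real_mult[OF computable_real_const[OF range_uminus_one] assms] by simp

lemma computable_real_diff [computable_intros]:
  assumes "computable \<nu> f" "computable \<nu> g"
  shows "computable \<nu> (\<lambda>x. f x - g x :: real)"
  using computable_real_add[OF assms(1) computable_real_uminus[OF assms(2)]] by simp

lemma computable_name [computable_intros]: "computable \<nu> f \<Longrightarrow> computable \<nu> (\<lambda>x. \<nu> (f x))"
  by (rule computable_comp[of _ \<nu>], rule computableI[OF rec_unary_id]) auto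

text \<open>Unbounded search for a name of the inverse. It terminates because the named numbers are
  closed under \<open>inverse\<close>, and candidates are checked by multiplication and
  comparison.\<close>

lemma computable_real_inverse [computable_intros]:
  assumes "computable \<nu> f" shows "computable \<nu> (\<lambda>x. inverse (f x) :: real)"
proof (rule computable_comp[OF _ assms])
  \<comment> \<open>The second disjunct reflects \<open>inverse 0 = 0\<close> and keeps the search
    total.\<close>
  define test where "test p \<longleftrightarrow> \<nu> (fst p) * \<nu> (snd p) = 1 \<or> \<nu> (snd p) = 0 \<and> \<nu> (fst p) = 0" for p
  define t :: "nat \<Rightarrow> nat" where "t n = of_bool (\<not> test (prod_decode n))" for n
  have test: "test (y, n) \<longleftrightarrow> \<nu> y = inverse (\<nu> n)" for y n
    by (cases "\<nu> n = 0") (auto simp: test_def field_simps)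
  have t0: "t (prod_encode (y, n)) = 0 \<longleftrightarrow> \<nu> y = inverse (\<nu> n)" for y n
    by (simp add: t_def test)
  have ex: "\<exists>y. t (prod_encode (y, n)) = 0" for n
    unfolding t0 using range_inverse[of n] by (metis imageE)
  have "computable \<nu> t"
    unfolding t_def test_def by (intro computable_intros)
  then have "rec_unary t" by (simp add: computable_nat_iff)
  from rec_unary_Least[OF this ex] show "computable \<nu> (inverse :: real \<Rightarrow> real)"
    by (rule computableI) (use LeastI_ex[OF ex] in \<open>simp add: t0\<close>)
qed

lemma computable_real_sum_list [computable_intros]:
  assumes "computable \<nu> f" shows "computable \<nu> (\<lambda>x. sum_list (f x) :: real)"
  unfolding sum_list.eq_foldr by (intro computable_intros assms)

lemma computable_real_of_int_decode [computable_intros]: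
  assumes "computable \<nu> f" shows "computable \<nu> (\<lambda>x. real_of_int (int_decode (f x)))"
proof (rule computable_comp[OF _ assms])
  (* int_decode enumerates 0, -1, 1, -2, 2, ...: two consecutive values add up to -1 or 0,
     depending on the parity, which is the second component of the state. *)
  have "rec_nat (0, 0) (\<lambda>_ s. (snd s - fst s - 1, 1 - snd s)) n =
      (real_of_int (int_decode n), if even n then 0 else 1)" for n
  proof (induction n)
    case (Suc n)
    then show ?case
      by (cases "even n") (auto simp: int_decode_def sum_decode_def elim!: evenE oddE)
  qed (simp add: int_decode_def sum_decode_def)
  then have "real_of_int (int_decode n) =
      fst (rec_nat (0, 0) (\<lambda>_ s. (snd s - fst s - 1, 1 - snd s)) n)" for n
    by simp
  then show "computable \<nu> (\<lambda>n. real_of_int (int_decode n))"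
    by (simp only:) (intro computable_intros)
qed

text \<open>Turns the rational coefficients of a description into names, so that they can be mixed
  with those of the formula. Inversion serves this purpose; the elimination itself does not
  divide.\<close>

lemma computable_of_rat [computable_intros]:
  assumes "computable \<nu> f" shows "computable \<nu> (\<lambda>x. of_rat (f x) :: real)"
proof (rule computable_comp[OF _ assms])
  have enc: "computable \<nu> rat_encode"
    by (rule computableI[OF rec_unary_id]) simp
  have "of_rat r = real_of_int (int_decode (fst (prod_decode (rat_encode r)))) *
      inverse (real_of_int (int_decode (snd (prod_decode (rat_encode r)))))" for r
  proof -
    obtain a b where ab: "quotient_of r = (a, b)" by fastforce
    then have "r = of_int a / of_int b" by (rule quotient_of_div)
    then have "of_rat r = real_of_int a / real_of_int b" by (simp add: of_rat_divide)
    then show ?thesis by (simp add: rat_encode_def ab divide_inverse)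
  qed
  then show "computable \<nu> (\<lambda>r. of_rat r :: real)"
    by (simp only:) (intro computable_intros enc)
qed

end

section \<open>Fourier--Motzkin elimination\<close>

text \<open>
  The row \<open>([(c\<^sub>1, i\<^sub>1), \<dots>], d, s)\<close> stands for \<open>c\<^sub>1 v\<^bsub>i\<^sub>1\<^esub> + \<dots> + d \<le> 0\<close>, and for the strict inequality
  if \<open>s\<close> holds.  An index may occur repeatedly.
\<close>

type_synonym row = "(real \<times> nat) list \<times> real \<times> bool"

definition neg_val :: "bool \<Rightarrow> real \<Rightarrow> bool" where
  "neg_val s z \<longleftrightarrow> (if s then z < 0 else z \<le> 0)"

definition lin_val :: "(nat \<Rightarrow> real) \<Rightarrow> (real \<times> nat) list \<Rightarrow> real" where
  "lin_val v ts = (\<Sum>p\<leftarrow>ts. fst p * v (snd p))"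

definition row_holds :: "(nat \<Rightarrow> real) \<Rightarrow> row \<Rightarrow> bool" where
  "row_holds v r \<longleftrightarrow> neg_val (snd (snd r)) (lin_val v (fst r) + fst (snd r))"

definition coef :: "nat \<Rightarrow> (real \<times> nat) list \<Rightarrow> real" where
  "coef i ts = sum_list (map fst (filter (\<lambda>p. snd p = i) ts))"

definition drop_var :: "nat \<Rightarrow> (real \<times> nat) list \<Rightarrow> (real \<times> nat) list" where
  "drop_var i ts = filter (\<lambda>p. snd p \<noteq> i) ts"

definition scale :: "real \<Rightarrow> (real \<times> nat) list \<Rightarrow> (real \<times> nat) list" where
  "scale a ts = map (\<lambda>p. (a * fst p, snd p)) ts"

text \<open>Intended for \<open>u\<close> with positive and \<open>l\<close> with negative
  coefficient at \<open>i\<close>, an upper and a lower bound for that variable. Both rows are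
  multiplied by positive factors chosen so that the terms in \<open>i\<close> cancel, which avoids
  division.\<close>

definition combine :: "nat \<Rightarrow> row \<Rightarrow> row \<Rightarrow> row" where
  "combine i u l =
     (scale (- coef i (fst l)) (drop_var i (fst u)) @ scale (coef i (fst u)) (drop_var i (fst l)),
      - coef i (fst l) * fst (snd u) + coef i (fst u) * fst (snd l),
      snd (snd u) \<or> snd (snd l))"

definition eliminate :: "nat \<Rightarrow> row list \<Rightarrow> row list" where
  "eliminate i R =
     map (\<lambda>r. (drop_var i (fst r), snd r)) (filter (\<lambda>r. coef i (fst r) = 0) R) @
     concat (map (\<lambda>u. map (combine i u) (filter (\<lambda>l. coef i (fst l) < 0) R))
       (filter (\<lambda>u. 0 < coef i (fst u)) R))"

text \<open>Every index occurring in \<open>R\<close> is eliminated, possibly several times; a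
  repetition preserves satisfiability. Only constants remain to be checked.\<close>

definition feasible :: "row list \<Rightarrow> bool" where
  "feasible R \<longleftrightarrow>
     list_all (\<lambda>r. neg_val (snd (snd r)) (fst (snd r)))
       (foldl (\<lambda>R i. eliminate i R) R (concat (map (\<lambda>r. map snd (fst r)) R)))"

section \<open>Correctness of the elimination\<close>

text \<open>The side conditions prepare for strict inequalities: \<open>y\<close> touches a lower
  bound only when an upper bound coincides with it, and vice versa. The midpoint of the largest
  lower and the smallest upper bound does this, since touching a bound forces these two to be
  equal.\<close>

lemma exists_between_finite:
  fixes L U :: "real set"
  assumes fin: "finite L" "finite U" and le: "\<And>l u. l \<in> L \<Longrightarrow> u \<in> U \<Longrightarrow> l \<le> u"
  shows "\<exists>y. (\<forall>l\<in>L. l \<le> y \<and> (l = y \<longrightarrow> l \<in> U)) \<and> (\<forall>u\<in>U. y \<le> u \<and> (u = y \<longrightarrow> u \<in> L))"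
proof (cases "L = {}")
  case True
  show ?thesis
  proof (cases "U = {}")
    case False
    have "Min U - 1 < u" if "u \<in> U" for u using fin that Min_le[of U u] by linarith
    then show ?thesis using True by (intro exI[of _ "Min U - 1"]) (auto intro: less_imp_le)
  qed (use True in auto)
next
  case L: False
  show ?thesis
  proof (cases "U = {}")
    case True
    have "l < Max L + 1" if "l \<in> L" for l using fin that Max_ge[of L l] by linarith
    then show ?thesis using True by (intro exI[of _ "Max L + 1"]) (auto intro: less_imp_le)
  next
    case False
    have M: "Max L \<in> L" "Min U \<in> U" "Max L \<le> Min U" using L False fin le by auto
    define y where "y = (Max L + Min U) / 2"
    have "l \<le> y \<and> (l = y \<longrightarrow> l \<in> U)" if "l \<in> L" for l
    proof -
      have l: "l \<le> Max L" using that fin by simp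
      have "l = y \<Longrightarrow> l = Min U" using l M by (simp add: y_def)
      moreover have "l \<le> y" using l M by (simp add: y_def)
      ultimately show ?thesis using M by auto
    qed
    moreover have "y \<le> u \<and> (u = y \<longrightarrow> u \<in> L)" if "u \<in> U" for u
    proof -
      have u: "Min U \<le> u" using that fin by simp
      have "u = y \<Longrightarrow> u = Max L" using u M by (simp add: y_def)
      moreover have "y \<le> u" using u M by (simp add: y_def)
      ultimately show ?thesis using M by auto
    qed
    ultimately show ?thesis by blast
  qed
qed

text \<open>Left to right, positive multiples of two rows are added. Right to left, \<open>y\<close>
  is placed between the finitely many bounds; a strict row is met because its bound differs from
  every bound on the opposite side.\<close>

lemma one_variable_elimination:
  fixes a b :: "'r \<Rightarrow> real"
  assumes "finite R"
  shows "(\<exists>y. \<forall>r\<in>R. neg_val (s r) (a r * y + b r)) \<longleftrightarrow>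
    (\<forall>r\<in>R. a r = 0 \<longrightarrow> neg_val (s r) (b r)) \<and>
    (\<forall>u\<in>R. \<forall>l\<in>R. 0 < a u \<longrightarrow> a l < 0 \<longrightarrow> neg_val (s u \<or> s l) (- a l * b u + a u * b l))"
    (is "?lhs \<longleftrightarrow> ?rhs")
proof
  assume ?lhs
  then obtain y where y: "\<And>r. r \<in> R \<Longrightarrow> neg_val (s r) (a r * y + b r)" by blast
  have "neg_val (s u \<or> s l) (- a l * b u + a u * b l)"
    if "u \<in> R" "l \<in> R" "0 < a u" "a l < 0" for u l
  proof -
    have eq: "- a l * b u + a u * b l = - a l * (a u * y + b u) + a u * (a l * y + b l)"
      by (simp add: algebra_simps)
    have le: "- a l * (a u * y + b u) \<le> 0" "a u * (a l * y + b l) \<le> 0"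
      using y[OF that(1)] y[OF that(2)] that(3,4)
      by (auto simp: neg_val_def mult_le_0_iff zero_le_mult_iff split: if_splits)
    have "s u \<Longrightarrow> - a l * (a u * y + b u) < 0" "s l \<Longrightarrow> a u * (a l * y + b l) < 0"
      using y[OF that(1)] y[OF that(2)] that(3,4)
      by (auto simp: neg_val_def mult_less_0_iff zero_less_mult_iff)
    then show ?thesis
      unfolding eq using le unfolding neg_val_def by (auto intro: add_neg_nonpos add_nonpos_neg)
  qed
  then show ?rhs using y by fastforce
next
  assume rhs: ?rhs
  \<comment> \<open>The value of \<open>y\<close> at which row \<open>r\<close> becomes an equality:
    a lower bound if \<open>a r < 0\<close>, an upper bound if \<open>0 < a r\<close>.\<close>
  define bd where "bd r = - b r / a r" for r
  have frac: "f / p \<le> - g / q \<longleftrightarrow> p * g + q * f \<le> 0" "f / p < - g / q \<longleftrightarrow> p * g + q * f < 0"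
    if "0 < p" "0 < q" for f g p q :: real
    using that by (simp_all add: field_simps) (linarith+)
  have bd_le: "bd l \<le> bd u \<longleftrightarrow> - a l * b u + a u * b l \<le> 0"
    and bd_less: "bd l < bd u \<longleftrightarrow> - a l * b u + a u * b l < 0" if "a l < 0" "0 < a u" for l u
    using frac[of "- a l" "a u" "b l" "b u"] that by (simp_all add: bd_def)
  have "\<exists>y. (\<forall>l\<in>bd ` {l\<in>R. a l < 0}. l \<le> y \<and> (l = y \<longrightarrow> l \<in> bd ` {u\<in>R. 0 < a u})) \<and>
      (\<forall>u\<in>bd ` {u\<in>R. 0 < a u}. y \<le> u \<and> (u = y \<longrightarrow> u \<in> bd ` {l\<in>R. a l < 0}))"
  proof (rule exists_between_finite)
    fix x z
    assume "x \<in> bd ` {l\<in>R. a l < 0}" "z \<in> bd ` {u\<in>R. 0 < a u}"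
    then obtain l u where lu: "l \<in> R" "a l < 0" "x = bd l" "u \<in> R" "0 < a u" "z = bd u" by auto
    then have "neg_val (s u \<or> s l) (- a l * b u + a u * b l)" using rhs by blast
    then have "- a l * b u + a u * b l \<le> 0" by (auto simp: neg_val_def split: if_splits)
    then show "x \<le> z" using lu bd_le by simp
  qed (use assms in auto)
  then obtain y where y:
    "\<forall>l\<in>bd ` {l\<in>R. a l < 0}. l \<le> y \<and> (l = y \<longrightarrow> l \<in> bd ` {u\<in>R. 0 < a u})"
    "\<forall>u\<in>bd ` {u\<in>R. 0 < a u}. y \<le> u \<and> (u = y \<longrightarrow> u \<in> bd ` {l\<in>R. a l < 0})"
    by (elim exE conjE)
  have lo: "bd l \<le> y \<and> (bd l = y \<longrightarrow> bd l \<in> bd ` {u\<in>R. 0 < a u})" if "l \<in> R" "a l < 0" for l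
    by (rule bspec[OF y(1)]) (use that in blast)
  have up: "y \<le> bd u \<and> (bd u = y \<longrightarrow> bd u \<in> bd ` {l\<in>R. a l < 0})" if "u \<in> R" "0 < a u" for u
    by (rule bspec[OF y(2)]) (use that in blast)
  have strict: "bd l < bd u" if "l \<in> R" "a l < 0" "u \<in> R" "0 < a u" "s l \<or> s u" for l u
  proof -
    have "neg_val (s u \<or> s l) (- a l * b u + a u * b l)" using rhs that by blast
    then have "- a l * b u + a u * b l < 0" using that(5) by (auto simp: neg_val_def)
    then show ?thesis using that bd_less by simp
  qed
  have "neg_val (s r) (a r * y + b r)" if r: "r \<in> R" for r
  proof -
    consider "a r = 0" | "a r < 0" | "0 < a r" by linarith
    then show ?thesis
    proof cases
      case 1
      then show ?thesis using rhs r by simp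
    next
      case 2
      \<comment> \<open>A strict lower bound coincides with no upper bound, so \<open>y\<close> was
        not placed on it.\<close>
      have "bd r \<notin> bd ` {u\<in>R. 0 < a u}" if "s r"
        using strict[OF r 2] that by fastforce
      then have *: "bd r \<le> y" "s r \<Longrightarrow> bd r < y"
        using lo[OF r 2] by (simp, metis order_le_less)
      have "bd r \<le> y \<longleftrightarrow> a r * y + b r \<le> 0" "bd r < y \<longleftrightarrow> a r * y + b r < 0"
        using 2 by (simp_all add: bd_def field_simps) (linarith+)
      then show ?thesis using * by (simp add: neg_val_def)
    next
      case 3
      have "bd r \<notin> bd ` {l\<in>R. a l < 0}" if "s r"
        using strict[OF _ _ r 3] that by fastforce
      then have *: "y \<le> bd r" "s r \<Longrightarrow> y < bd r"
        using up[OF r 3] by (simp, metis order_le_less)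
      have "y \<le> bd r \<longleftrightarrow> a r * y + b r \<le> 0" "y < bd r \<longleftrightarrow> a r * y + b r < 0"
        using 3 by (simp_all add: bd_def field_simps) (linarith+)
      then show ?thesis using * by (simp add: neg_val_def)
    qed
  qed
  then show ?lhs by blast
qed

lemma lin_val_simps [simp]:
  "lin_val v [] = 0"
  "lin_val v (p # ts) = fst p * v (snd p) + lin_val v ts"
  "lin_val v (ts @ us) = lin_val v ts + lin_val v us"
  by (simp_all add: lin_val_def)

lemma lin_val_scale: "lin_val v (scale a ts) = a * lin_val v ts"
  by (induction ts) (simp_all add: scale_def algebra_simps)

lemma lin_val_upd: "lin_val (v(i := y)) ts = coef i ts * y + lin_val v (drop_var i ts)"
  by (induction ts) (auto simp: coef_def drop_var_def algebra_simps)

lemma eliminate_iff: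
  "(\<exists>y. \<forall>r\<in>set R. row_holds (v(i := y)) r) \<longleftrightarrow> (\<forall>r\<in>set (eliminate i R). row_holds v r)"
proof -
  let ?b = "\<lambda>r :: row. lin_val v (drop_var i (fst r)) + fst (snd r)"
  have "row_holds (v(i := y)) r = neg_val (snd (snd r)) (coef i (fst r) * y + ?b r)" for y r
    by (simp add: row_holds_def lin_val_upd add.assoc)
  moreover have "row_holds v (drop_var i (fst r), snd r) = neg_val (snd (snd r)) (?b r)" for r
    by (simp add: row_holds_def)
  moreover have "row_holds v (combine i u l) = neg_val (snd (snd u) \<or> snd (snd l))
      (- coef i (fst l) * ?b u + coef i (fst u) * ?b l)" for u l
    by (simp add: row_holds_def combine_def lin_val_scale algebra_simps)
  ultimately show ?thesis
    using one_variable_elimination[of "set R" "\<lambda>r. snd (snd r)" "\<lambda>r. coef i (fst r)" ?b]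
    unfolding eliminate_def by (auto simp: ball_Un simp del: split_paired_All)
qed

lemma satisfiable_foldl_eliminate:
  "(\<exists>v. \<forall>r\<in>set (foldl (\<lambda>R i. eliminate i R) R is). row_holds v r) \<longleftrightarrow>
    (\<exists>v. \<forall>r\<in>set R. row_holds v r)"
proof (induction "is" arbitrary: R)
  case (Cons i "is")
  have "(\<exists>v. \<forall>r\<in>set (eliminate i R). row_holds v r) \<longleftrightarrow> (\<exists>v. \<forall>r\<in>set R. row_holds v r)"
    \<comment> \<open>A solution \<open>v\<close> of \<open>R\<close> is also of the form
      \<open>v(i := v i)\<close>.\<close>
    unfolding eliminate_iff[symmetric] by (rule iffI, blast, elim exE, metis fun_upd_triv)
  then show ?case using Cons by simp
qed simp

definition row_vars :: "row list \<Rightarrow> nat set" where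
  "row_vars R = (\<Union>r\<in>set R. snd ` set (fst r))"

text \<open>Eliminated variables never return, so eliminating all of them leaves rows without
  variables.\<close>

lemma row_vars_eliminate: "row_vars (eliminate i R) \<subseteq> row_vars R - {i}"
proof -
  have drop: "snd ` set (drop_var i ts) = snd ` set ts - {i}" for ts
    unfolding drop_var_def by (induction ts) auto
  have scale: "snd ` set (scale a ts) = snd ` set ts" for a ts
    by (simp add: scale_def image_image)
  have "snd ` set (fst r) \<subseteq> row_vars R - {i}" if r: "r \<in> set (eliminate i R)" for r
  proof -
    have R: "snd ` set (fst q) \<subseteq> row_vars R" if "q \<in> set R" for q
      using that unfolding row_vars_def by blast
    consider q where "q \<in> set R" "r = (drop_var i (fst q), snd q)"
      | u l where "u \<in> set R" "l \<in> set R" "r = combine i u l"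
      using r unfolding eliminate_def by (auto simp del: split_paired_All split_paired_Ex)
    then show ?thesis
    proof cases
      case 1
      then show ?thesis using R[of q] drop[of "fst q"] by auto
    next
      case 2
      have *: "snd ` set (fst r) = (snd ` set (fst u) - {i}) \<union> (snd ` set (fst l) - {i})"
        unfolding 2(3) combine_def by (simp add: image_Un drop scale)
      show ?thesis
        unfolding * by (intro Un_least Diff_mono R[OF 2(1)] R[OF 2(2)] order_refl)
    qed
  qed
  then show ?thesis unfolding row_vars_def[of "eliminate i R"] by (rule UN_least)
qed

lemma row_vars_foldl_eliminate:
  "row_vars (foldl (\<lambda>R i. eliminate i R) R is) \<subseteq> row_vars R - set is"
proof (induction "is" arbitrary: R)
  case (Cons i "is")
  from Cons[of "eliminate i R"] row_vars_eliminate[of i R] show ?case by auto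
qed simp

lemma feasible_iff: "feasible R \<longleftrightarrow> (\<exists>v. \<forall>r\<in>set R. row_holds v r)"
proof -
  define vs where "vs = concat (map (\<lambda>r. map snd (fst r)) R)"
  define R' where "R' = foldl (\<lambda>R i. eliminate i R) R vs"
  have "row_vars R' \<subseteq> row_vars R - set vs"
    unfolding R'_def by (rule row_vars_foldl_eliminate)
  then have "row_vars R' = {}" by (auto simp: vs_def row_vars_def)
  then have "row_holds v r \<longleftrightarrow> neg_val (snd (snd r)) (fst (snd r))" if "r \<in> set R'" for v r
    using that by (auto simp: row_vars_def row_holds_def)
  then have "feasible R \<longleftrightarrow> (\<exists>v. \<forall>r\<in>set R'. row_holds v r)"
    by (auto simp: feasible_def R'_def vs_def list_all_iff)
  then show ?thesis by (simp add: R'_def satisfiable_foldl_eliminate)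
qed

section \<open>Computability of the elimination\<close>

context effective_field
begin

lemma computable_neg_val [computable_intros]:
  "computable \<nu> f \<Longrightarrow> computable \<nu> g \<Longrightarrow> computable \<nu> (\<lambda>x. neg_val (f x) (g x))"
  unfolding neg_val_def by (intro computable_intros)

lemma computable_coef [computable_intros]:
  "computable \<nu> f \<Longrightarrow> computable \<nu> g \<Longrightarrow> computable \<nu> (\<lambda>x. coef (f x) (g x))"
  by (rule computable_comp2) (unfold coef_def, intro computable_intros)

lemma computable_drop_var [computable_intros]:
  "computable \<nu> f \<Longrightarrow> computable \<nu> g \<Longrightarrow> computable \<nu> (\<lambda>x. drop_var (f x) (g x))"
  by (rule computable_comp2) (unfold drop_var_def, intro computable_intros)

lemma computable_scale [computable_intros]:
  "computable \<nu> f \<Longrightarrow> computable \<nu> g \<Longrightarrow> computable \<nu> (\<lambda>x. scale (f x) (g x))"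
  by (rule computable_comp2) (unfold scale_def, intro computable_intros)

lemma computable_combine [computable_intros]:
  "computable \<nu> f \<Longrightarrow> computable \<nu> g \<Longrightarrow> computable \<nu> h \<Longrightarrow>
    computable \<nu> (\<lambda>x. combine (f x) (g x) (h x))"
  unfolding combine_def by (intro computable_intros)

lemma computable_eliminate [computable_intros]:
  "computable \<nu> f \<Longrightarrow> computable \<nu> g \<Longrightarrow> computable \<nu> (\<lambda>x. eliminate (f x) (g x))"
  by (rule computable_comp2) (unfold eliminate_def, intro computable_intros)

lemma computable_feasible [computable_intros]:
  "computable \<nu> f \<Longrightarrow> computable \<nu> (\<lambda>x. feasible (f x))"
  by (rule computable_comp[of _ feasible]) (unfold feasible_def, intro computable_intros)

end

section \<open>Disjunctive normal forms\<close>

definition dnf_holds :: "(nat \<Rightarrow> real) \<Rightarrow> row list list \<Rightarrow> bool" where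
  "dnf_holds v A \<longleftrightarrow> (\<exists>C\<in>set A. \<forall>r\<in>set C. row_holds v r)"

definition dnf_and :: "row list list \<Rightarrow> row list list \<Rightarrow> row list list" where
  "dnf_and A B = concat (map (\<lambda>a. map (\<lambda>b. a @ b) B) A)"

lemma dnf_holds_and [simp]: "dnf_holds v (dnf_and A B) \<longleftrightarrow> dnf_holds v A \<and> dnf_holds v B"
  unfolding dnf_holds_def dnf_and_def by (simp add: ball_Un)

lemma dnf_holds_append [simp]: "dnf_holds v (A @ B) \<longleftrightarrow> dnf_holds v A \<or> dnf_holds v B"
  by (auto simp: dnf_holds_def)

lemma feasible_dnf_iff: "list_ex feasible A \<longleftrightarrow> (\<exists>v. dnf_holds v A)"
  by (auto simp: list_ex_iff feasible_iff dnf_holds_def)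

lemma lin_val_zip: "length c = length is \<Longrightarrow> lin_val v (zip c is) = dot c (map v is)"
  by (induction c "is" rule: list_induct2)
    (simp_all add: dot_def sum.lessThan_Suc_shift del: sum.lessThan_Suc)

text \<open>Serves the negated atom, which is stored as a strict row with all signs
  reversed.\<close>

lemma dot_uminus: "dot (map uminus c) v = - dot c v"
  by (simp add: dot_def sum_negf)

primrec lin_dnf :: "nat list \<Rightarrow> lin \<Rightarrow> row list list" where
  "lin_dnf is (Le c d) = [[(zip (map of_rat c) is, - of_rat d, False)]]"
| "lin_dnf is (Less c d) = [[(zip (map of_rat c) is, - of_rat d, True)]]"
| "lin_dnf is (And p q) = dnf_and (lin_dnf is p) (lin_dnf is q)"
| "lin_dnf is (Or p q) = lin_dnf is p @ lin_dnf is q"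

lemma dnf_holds_lin_dnf:
  "lin_over (length is) p \<Longrightarrow> dnf_holds v (lin_dnf is p) \<longleftrightarrow> lin_holds (map v is) p"
  by (induction p)
    (auto simp: dnf_holds_def[of _ "[[_]]"] row_holds_def neg_val_def lin_val_zip)

text \<open>Realises \<open>Next\<close>: one time step later means \<open>w\<close> variables
  further on.\<close>

definition shift_dnf :: "nat \<Rightarrow> row list list \<Rightarrow> row list list" where
  "shift_dnf w A = map (map (\<lambda>r. (map (\<lambda>p. (fst p, snd p + w)) (fst r), snd r))) A"

lemma dnf_holds_shift [simp]: "dnf_holds v (shift_dnf w A) \<longleftrightarrow> dnf_holds (\<lambda>i. v (i + w)) A"
proof -
  have "lin_val v (map (\<lambda>p. (fst p, snd p + w)) ts) = lin_val (\<lambda>i. v (i + w)) ts" for ts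
    by (induction ts) simp_all
  then show ?thesis by (simp add: dnf_holds_def shift_dnf_def row_holds_def)
qed

text \<open>
  Computes normal forms of the formula and of its negation at once.  The argument \<open>(m, w)\<close> says that
  the state at time \<open>t\<close> is stored in the variables \<open>t w, \<dots>, t w + m - 1\<close>.
\<close>

primrec ltl_dnf :: "nat \<times> nat \<Rightarrow> real ltl \<Rightarrow> row list list \<times> row list list" where
  "ltl_dnf k (Atom c d) =
     ([[(zip c (segment 0 (fst k)), - d, False)]],
      [[(zip (map uminus c) (segment 0 (fst k)), d, True)]])"
| "ltl_dnf k (Neg p) = (snd (ltl_dnf k p), fst (ltl_dnf k p))"
| "ltl_dnf k (Conj p q) =
     (dnf_and (fst (ltl_dnf k p)) (fst (ltl_dnf k q)), snd (ltl_dnf k p) @ snd (ltl_dnf k q))"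
| "ltl_dnf k (Disj p q) =
     (fst (ltl_dnf k p) @ fst (ltl_dnf k q), dnf_and (snd (ltl_dnf k p)) (snd (ltl_dnf k q)))"
| "ltl_dnf k (Next p) =
     (shift_dnf (snd k) (fst (ltl_dnf k p)), shift_dnf (snd k) (snd (ltl_dnf k p)))"
| "ltl_dnf k (Until p q) = ([], [])"
| "ltl_dnf k (Release p q) = ([], [])"
| "ltl_dnf k (Always p) = ([], [])"
| "ltl_dnf k (Eventually p) = ([], [])"

lemma ltl_holds_Suc:
  "bounded_ltl p \<Longrightarrow> ltl_holds x (Suc t) p \<longleftrightarrow> ltl_holds (\<lambda>s. x (Suc s)) t p"
  by (induction p arbitrary: t) simp_all

lemma length_segment [simp]: "length (segment a n) = n"
  by (simp add: segment_def)

lemma nth_segment [simp]: "i < n \<Longrightarrow> segment a n ! i = a + i"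
  by (simp add: segment_def)

lemma segment_add: "segment a (n + k) = segment a n @ segment (a + n) k"
  by (simp add: segment_def add.assoc upt_add_eq_append[of a "a + n" k, simplified add.assoc])

lemma map_segment_shift: "map (\<lambda>i. v (i + w)) (segment a n) = map v (segment (a + w) n)"
  by (rule nth_equalityI) (simp_all add: add_ac)

lemma dnf_holds_ltl_dnf:
  assumes "bounded_ltl p" "ltl_over m p"
  shows "(dnf_holds v (fst (ltl_dnf (m, w) p)) \<longleftrightarrow>
      ltl_holds (\<lambda>t. map v (segment (t * w) m)) 0 p) \<and>
    (dnf_holds v (snd (ltl_dnf (m, w) p)) \<longleftrightarrow>
      \<not> ltl_holds (\<lambda>t. map v (segment (t * w) m)) 0 p)"
  using assms
proof (induction p arbitrary: v)
  case (Atom c d)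
  then show ?case
    by (auto simp: dnf_holds_def row_holds_def neg_val_def lin_val_zip dot_uminus)
next
  case (Next p)
  then show ?case by (simp add: ltl_holds_Suc map_segment_shift add.commute)
qed auto

text \<open>The code of a formula serves as a crude bound on its nesting depth of \<open>Next\<close>.\<close>

lemma ltl_holds_cong_bounded:
  assumes "bounded_ltl \<phi>" "\<And>s. t \<le> s \<Longrightarrow> s \<le> t + ltl_encode \<phi> \<Longrightarrow> x s = x' s"
  shows "ltl_holds x t (map_ltl \<nu> \<phi>) \<longleftrightarrow> ltl_holds x' t (map_ltl \<nu> \<phi>)"
  using assms
proof (induction \<phi> arbitrary: t)
  case (Neg p)
  have "ltl_encode p \<le> ltl_encode (Neg p)" by (simp add: le_prod_encode_2)
  with Neg show ?case by simp
next
  case (Conj p q)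
  have "ltl_encode p \<le> ltl_encode (Conj p q)" "ltl_encode q \<le> ltl_encode (Conj p q)"
    unfolding ltl_encode.simps
    by (rule order_trans[OF le_prod_encode_1 le_prod_encode_2],
        rule order_trans[OF le_prod_encode_2 le_prod_encode_2])
  with Conj show ?case by simp
next
  case (Disj p q)
  have "ltl_encode p \<le> ltl_encode (Disj p q)" "ltl_encode q \<le> ltl_encode (Disj p q)"
    unfolding ltl_encode.simps
    by (rule order_trans[OF le_prod_encode_1 le_prod_encode_2],
        rule order_trans[OF le_prod_encode_2 le_prod_encode_2])
  with Disj show ?case by simp
next
  case (Next p)
  have "ltl_encode p < ltl_encode (Next p)" by (simp add: prod_encode_less)
  with Next show ?case by simp
qed simp_all

section \<open>Unsafe runs of a system\<close>

text \<open>
  The variables \<open>t w, \<dots>, t w + w - 1\<close>, where \<open>w\<close> exceeds the sum of the dimensions \<open>m\<close>, \<open>np\<close>, \<open>nn\<close>, \<open>nq\<close>,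
  hold the environment state, the observations, the hidden states and the actions at time \<open>t\<close>.  The
  extra variable makes \<open>w\<close> positive.
\<close>

definition block_width :: "nat \<Rightarrow> nat \<Rightarrow> nat \<Rightarrow> nat \<Rightarrow> nat" where
  "block_width m nq np nn = Suc (m + np + nn + nq)"

text \<open>The order state, observations, hidden states, actions within a block makes the arguments
  of \<open>ob\<close> and all but the last argument of \<open>po\<close> contiguous.\<close>

definition step_dnf ::
    "nat \<Rightarrow> nat \<Rightarrow> nat \<Rightarrow> nat \<Rightarrow> lin \<Rightarrow> lin \<Rightarrow> lin \<Rightarrow> nat \<Rightarrow> row list list" where
  "step_dnf m nq np nn tr po ob t =
    dnf_and (lin_dnf (segment (t * block_width m nq np nn) (m + np)) ob)
     (dnf_and
       (lin_dnf (segment (t * block_width m nq np nn + m) (np + nn + nq) @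
          segment (Suc t * block_width m nq np nn + m + np) nn) po)
       (lin_dnf (segment (t * block_width m nq np nn) m @
          segment (t * block_width m nq np nn + m + np + nn) nq @
          segment (Suc t * block_width m nq np nn) m) tr))"

text \<open>\<open>[[]]\<close>, a single empty conjunction, is the normal form of truth. The
  argument \<open>ng\<close> is the normal form of the negated formula.\<close>

definition unsafe_dnf ::
    "nat \<Rightarrow> nat \<Rightarrow> nat \<Rightarrow> nat \<Rightarrow> lin \<Rightarrow> lin \<Rightarrow> lin \<Rightarrow> lin \<Rightarrow> lin \<Rightarrow> nat \<Rightarrow> row list list \<Rightarrow>
      row list list" where
  "unsafe_dnf m nq np nn tr po ob ie ih k ng =
    dnf_and (lin_dnf (segment 0 m) ie) (dnf_and (lin_dnf (segment (m + np) nn) ih)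
      (dnf_and (rec_nat [[]] (\<lambda>t A. dnf_and A (step_dnf m nq np nn tr po ob t)) k) ng))"

text \<open>A run as the constraints see it: joint vectors are flattened, and membership in the
  domains of the system is not stated. Values beyond time \<open>k\<close> matter only as far as the
  formula refers to them.\<close>

definition unsafe_run ::
    "lin \<Rightarrow> lin \<Rightarrow> lin \<Rightarrow> lin \<Rightarrow> lin \<Rightarrow> nat \<Rightarrow> real ltl \<Rightarrow> (nat \<Rightarrow> real list) \<Rightarrow> (nat \<Rightarrow> real list) \<Rightarrow>
      (nat \<Rightarrow> real list) \<Rightarrow> (nat \<Rightarrow> real list) \<Rightarrow> bool" where
  "unsafe_run tr po ob ie ih k p X Y H A \<longleftrightarrow>
     lin_holds (X 0) ie \<and> lin_holds (H 0) ih \<and>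
     (\<forall>t<k. lin_holds (X t @ Y t) ob \<and> lin_holds (Y t @ H t @ A t @ H (Suc t)) po \<and>
        lin_holds (X t @ A t @ X (Suc t)) tr) \<and>
     \<not> ltl_holds X 0 p"

lemma dnf_holds_unsafe_dnf:
  assumes "lin_over (m + nq + m) tr" "lin_over (np + nn + nq + nn) po" "lin_over (m + np) ob"
    "lin_over m ie" "lin_over nn ih" "bounded_ltl p" "ltl_over m p"
  defines "w \<equiv> block_width m nq np nn"
  shows "dnf_holds v (unsafe_dnf m nq np nn tr po ob ie ih k (snd (ltl_dnf (m, w) p))) \<longleftrightarrow>
    unsafe_run tr po ob ie ih k p
      (\<lambda>t. map v (segment (t * w) m)) (\<lambda>t. map v (segment (t * w + m) np))
      (\<lambda>t. map v (segment (t * w + m + np) nn)) (\<lambda>t. map v (segment (t * w + m + np + nn) nq))"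
proof -
  have step: "dnf_holds v (step_dnf m nq np nn tr po ob t) \<longleftrightarrow>
     lin_holds (map v (segment (t * w) m) @ map v (segment (t * w + m) np)) ob \<and>
     lin_holds (map v (segment (t * w + m) np) @ map v (segment (t * w + m + np) nn) @
       map v (segment (t * w + m + np + nn) nq) @ map v (segment (Suc t * w + m + np) nn)) po \<and>
     lin_holds (map v (segment (t * w) m) @ map v (segment (t * w + m + np + nn) nq) @
       map v (segment (Suc t * w) m)) tr" for t
    unfolding step_dnf_def dnf_holds_and w_def[symmetric]
    using assms(1-3) by (simp add: dnf_holds_lin_dnf segment_add add.assoc)
  have steps: "dnf_holds v (rec_nat [[]] (\<lambda>t A. dnf_and A (step_dnf m nq np nn tr po ob t)) k) \<longleftrightarrow>
      (\<forall>t<k. dnf_holds v (step_dnf m nq np nn tr po ob t))"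
    by (induction k) (auto simp: less_Suc_eq dnf_holds_def[of _ "[[]]"])
  show ?thesis
    unfolding unsafe_dnf_def unsafe_run_def dnf_holds_and steps step
    using assms(4-7) by (simp add: dnf_holds_lin_dnf dnf_holds_ltl_dnf)
qed

lemma exists_block_layout:
  fixes X Y H A :: "nat \<Rightarrow> real list"
  assumes len: "\<And>t. length (X t) = m" "\<And>t. length (Y t) = np" "\<And>t. length (H t) = nn"
    "\<And>t. length (A t) = nq"
  defines "w \<equiv> block_width m nq np nn"
  obtains v where
    "\<And>t. map v (segment (t * w) m) = X t" "\<And>t. map v (segment (t * w + m) np) = Y t"
    "\<And>t. map v (segment (t * w + m + np) nn) = H t"
    "\<And>t. map v (segment (t * w + m + np + nn) nq) = A t"
proof -
  define B where "B t = X t @ Y t @ H t @ A t" for t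
  \<comment> \<open>Variable \<open>n\<close> is entry \<open>n mod w\<close> of block
    \<open>n div w\<close>.\<close>
  define v where "v n = B (n div w) ! (n mod w)" for n
  have w: "m + np + nn + nq < w" by (simp add: w_def block_width_def)
  have v: "v (t * w + j) = B t ! j" if "j < w" for t j
    using that by (simp add: v_def)
  have "map v (segment (t * w) m) = X t" for t
    by (rule nth_equalityI) (use len w in \<open>auto simp: v B_def nth_append\<close>)
  moreover have "map v (segment (t * w + m) np) = Y t" for t
    by (rule nth_equalityI)
      (use len w in \<open>auto simp: v B_def nth_append add.assoc\<close>)
  moreover have "map v (segment (t * w + m + np) nn) = H t" for t
    by (rule nth_equalityI)
      (use len w in \<open>auto simp: v B_def nth_append add.assoc\<close>)
  moreover have "map v (segment (t * w + m + np + nn) nq) = A t" for t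
    by (rule nth_equalityI)
      (use len w in \<open>auto simp: v B_def nth_append add.assoc\<close>)
  ultimately show thesis by (rule that)
qed

section \<open>From solutions of the constraints to runs of the system\<close>

lemma length_concat_joint_vec: "a \<in> joint_vec ns \<Longrightarrow> length (concat a) = sum_list ns"
proof -
  assume "a \<in> joint_vec ns"
  then have "list_all2 (\<lambda>u n. length u = n) a ns"
    by (simp add: joint_vec_def cart_def list_all2_map2 vec_def)
  then show ?thesis by (induction rule: list_all2_induct) auto
qed

text \<open>Cuts a flat vector found by solving the inequalities back into one vector per
  agent.\<close>

lemma concat_joint_vec_surj:
  "length u = sum_list ns \<Longrightarrow> \<exists>a\<in>joint_vec ns. concat a = u"
proof (induction ns arbitrary: u)
  case (Cons n ns)
  then obtain a where "a \<in> joint_vec ns" "concat a = drop n u"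
    by (metis add_diff_cancel_left' length_drop sum_list.Cons)
  then have "take n u # a \<in> joint_vec (n # ns)" "concat (take n u # a) = u"
    using Cons.prems by (auto simp: joint_vec_def cart_def vec_def)
  then show ?case by blast
qed (simp add: joint_vec_def cart_def)

lemma joint_observe_in:
  assumes "mn_mas S" "x \<in> env S" shows "joint_observe S x \<in> joint_observations S"
proof -
  have "observe ag x \<in> observations ag" if "ag \<in> set (agents S)" for ag
    using assms that unfolding mn_mas_def mn_agent_def by blast
  then show ?thesis
    by (auto simp: joint_observe_def joint_observations_def cart_def list_all2_conv_all_nth)
qed

lemma cart_mono:
  "(\<And>x. x \<in> set xs \<Longrightarrow> f x \<subseteq> g x) \<Longrightarrow> cart (map f xs) \<subseteq> cart (map g xs)"
  unfolding cart_def by (auto simp: list_all2_conv_all_nth) (meson nth_mem subsetD)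

lemma joint_sets_subset:
  assumes "mn_mas S"
  shows "joint_actions S \<subseteq> joint_vec (map act_dim (agents S))"
    "joint_observations S \<subseteq> joint_vec (map obs_dim (agents S))"
    "joint_hiddens S \<subseteq> joint_vec (map hid_dim (agents S))"
  using assms unfolding joint_actions_def joint_observations_def joint_hiddens_def joint_vec_def
    mn_mas_def mn_agent_def map_map comp_def
  by (auto intro!: cart_mono)

text \<open>Dependent choice with the invariant that the current state is reachable and agrees with
  the given run up to time \<open>k\<close>. Up to \<open>k\<close> the run supplies the successor,
  afterwards deadlock freedom does.\<close>

lemma extend_finite_run:
  assumes S: "mn_mas S" "deadlock_free S"
    and init: "X 0 \<in> init_env S" "H 0 \<in> joint_init_hiddens S"
    and step: "\<And>t. t < k \<Longrightarrow> joint_policy S (joint_observe S (X t), H t) = (A t, H (Suc t)) \<and>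
      X (Suc t) \<in> transition S (X t) (A t)"
  obtains x h where "path S x h" "x 0 \<in> init_env S" "h 0 \<in> joint_init_hiddens S"
    "\<And>t. t \<le> k \<Longrightarrow> x t = X t"
proof -
  define P where "P t s \<longleftrightarrow> reachable S (fst s) (snd s) \<and> (t \<le> k \<longrightarrow> s = (X t, H t))" for t s
  define Q where "Q s s' \<longleftrightarrow> (\<exists>a. (a, snd s') = joint_policy S (joint_observe S (fst s), snd s) \<and>
      fst s' \<in> transition S (fst s) a)" for s s'
  have "\<exists>f. \<forall>t. P t (f t) \<and> Q (f t) (f (Suc t))"
  proof (rule dependent_nat_choice)
    show "\<exists>s. P 0 s"
      using reachable.init[OF init] by (auto simp: P_def)
    fix s t
    assume s: "P t s"
    have "\<exists>s'. Q s s' \<and> (Suc t \<le> k \<longrightarrow> s' = (X (Suc t), H (Suc t)))"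
    proof (cases "t < k")
      case True
      then have "s = (X t, H t)" using s by (simp add: P_def)
      then show ?thesis
        using step[OF True] by (intro exI[of _ "(X (Suc t), H (Suc t))"]) (auto simp: Q_def)
    next
      case False
      obtain a h' where a: "joint_policy S (joint_observe S (fst s), snd s) = (a, h')" by fastforce
      then obtain x' where "x' \<in> transition S (fst s) a"
        using s S(2) unfolding P_def deadlock_free_def by (metis all_not_in_conv fst_conv)
      then show ?thesis using False a by (intro exI[of _ "(x', h')"]) (auto simp: Q_def)
    qed
    then show "\<exists>s'. P (Suc t) s' \<and> Q s s'"
      using s reachable.step unfolding P_def Q_def by metis
  qed
  then obtain f where f: "\<And>t. P t (f t)" "\<And>t. Q (f t) (f (Suc t))" by blast
  show thesis
  proof (rule that[of "fst \<circ> f" "snd \<circ> f"])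
    show "path S (fst \<circ> f) (snd \<circ> f)"
      using f reachable_in[OF S(1)] by (auto simp: path_def P_def Q_def)
    have "f 0 = (X 0, H 0)" using f(1)[of 0] by (simp add: P_def)
    then show "(fst \<circ> f) 0 \<in> init_env S" "(snd \<circ> f) 0 \<in> joint_init_hiddens S"
      using init by simp_all
    show "(fst \<circ> f) t = X t" if "t \<le> k" for t using f(1)[of t] that by (simp add: P_def)
  qed
qed

text \<open>A violating path yields an unsafe run by flattening. Conversely, reachability places
  each state of an unsafe run inside the domains where \<open>describes\<close> is informative; the
  run then extends to a path that agrees with it long enough to violate the formula.\<close>

lemma mas_models_iff_no_unsafe_run:
  assumes S: "mn_mas S" "deadlock_free S" and D: "describes D S"
    and \<phi>: "bounded_ltl \<phi>"
  shows "mas_models S (map_ltl \<nu> \<phi>) \<longleftrightarrow>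
    \<not> (\<exists>X Y H A. (\<forall>t. length (X t) = env_dim S \<and>
          length (Y t) = sum_list (map obs_dim (agents S)) \<and>
          length (H t) = sum_list (map hid_dim (agents S)) \<and>
          length (A t) = sum_list (map act_dim (agents S))) \<and>
        unsafe_run (d_trans D) (d_policy D) (d_observe D) (d_init_env D) (d_init_hiddens D)
          (ltl_encode \<phi>) (map_ltl \<nu> \<phi>) X Y H A)" (is "_ \<longleftrightarrow> \<not> ?unsafe")
proof -
  define m qs ps ns where "m = env_dim S" and "qs = map act_dim (agents S)"
    and "ps = map obs_dim (agents S)" and "ns = map hid_dim (agents S)"
  note dims = m_def[symmetric] qs_def[symmetric] ps_def[symmetric] ns_def[symmetric]
  define k where "k = ltl_encode \<phi>"
  note D' = D[unfolded describes_def Let_def dims]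
  have "\<forall>x\<in>env S. \<forall>a\<in>joint_actions S. \<forall>x'\<in>vec m.
      lin_holds (x @ concat a @ x') (d_trans D) \<longleftrightarrow> x' \<in> transition S x a"
    using D' by (elim conjE)
  then have tr: "lin_holds (x @ concat a @ x') (d_trans D) \<longleftrightarrow> x' \<in> transition S x a"
    if "x \<in> env S" "a \<in> joint_actions S" "x' \<in> vec m" for x a x'
    using that by simp
  have "\<forall>y\<in>joint_observations S. \<forall>h\<in>joint_hiddens S. \<forall>a\<in>joint_vec qs. \<forall>h'\<in>joint_vec ns.
      lin_holds (concat y @ concat h @ concat a @ concat h') (d_policy D) \<longleftrightarrow>
      joint_policy S (y, h) = (a, h')"
    using D' by (elim conjE)
  then have po: "lin_holds (concat y @ concat h @ concat a @ concat h') (d_policy D) \<longleftrightarrow>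
      joint_policy S (y, h) = (a, h')"
    if "y \<in> joint_observations S" "h \<in> joint_hiddens S" "a \<in> joint_vec qs" "h' \<in> joint_vec ns"
    for y h a h'
    using that by simp
  have "\<forall>x\<in>env S. \<forall>y\<in>joint_vec ps.
      lin_holds (x @ concat y) (d_observe D) \<longleftrightarrow> joint_observe S x = y"
    using D' by (elim conjE)
  then have ob: "lin_holds (x @ concat y) (d_observe D) \<longleftrightarrow> joint_observe S x = y"
    if "x \<in> env S" "y \<in> joint_vec ps" for x y
    using that by simp
  have "\<forall>x\<in>vec m. lin_holds x (d_init_env D) \<longleftrightarrow> x \<in> init_env S"
    using D' by (elim conjE)
  then have ie: "lin_holds x (d_init_env D) \<longleftrightarrow> x \<in> init_env S" if "x \<in> vec m" for x
    using that by simp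
  have "\<forall>h\<in>joint_vec ns. lin_holds (concat h) (d_init_hiddens D) \<longleftrightarrow> h \<in> joint_init_hiddens S"
    using D' by (elim conjE)
  then have ih: "lin_holds (concat h) (d_init_hiddens D) \<longleftrightarrow> h \<in> joint_init_hiddens S"
    if "h \<in> joint_vec ns" for h
    using that by simp
  note sub = joint_sets_subset[OF S(1), unfolded dims]
  have env: "x \<in> vec m" if "x \<in> env S" for x
    using S(1) that unfolding mn_mas_def m_def by blast
  show ?thesis
  proof
    assume models: "mas_models S (map_ltl \<nu> \<phi>)"
    show "\<not> ?unsafe"
    proof
      assume ?unsafe
      then obtain X Y H A where
        len: "\<And>t. length (X t) = m" "\<And>t. length (Y t) = sum_list ps"
          "\<And>t. length (H t) = sum_list ns" "\<And>t. length (A t) = sum_list qs"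
        and run: "unsafe_run (d_trans D) (d_policy D) (d_observe D) (d_init_env D) (d_init_hiddens D)
          k (map_ltl \<nu> \<phi>) X Y H A"
        unfolding dims k_def by blast
      obtain y where y: "\<And>t. y t \<in> joint_vec ps" "\<And>t. concat (y t) = Y t"
        using concat_joint_vec_surj[OF len(2)] by metis
      obtain h where h: "\<And>t. h t \<in> joint_vec ns" "\<And>t. concat (h t) = H t"
        using concat_joint_vec_surj[OF len(3)] by metis
      obtain a where a: "\<And>t. a t \<in> joint_vec qs" "\<And>t. concat (a t) = A t"
        using concat_joint_vec_surj[OF len(4)] by metis
      have X: "X t \<in> vec m" for t using len by (simp add: vec_def)
      have init: "X 0 \<in> init_env S" "h 0 \<in> joint_init_hiddens S"
        using run ie[OF X] ih[OF h(1)] by (auto simp: unsafe_run_def h(2))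
      \<comment> \<open>Reachability is a premise here and is discharged below by an induction that
        itself uses \<open>step\<close>.\<close>
      have step: "joint_policy S (joint_observe S (X t), h t) = (a t, h (Suc t)) \<and>
          X (Suc t) \<in> transition S (X t) (a t)" if "t < k" "reachable S (X t) (h t)" for t
      proof -
        have in_S: "X t \<in> env S" "h t \<in> joint_hiddens S"
          using reachable_in[OF S(1) that(2)] by auto
        have *: "lin_holds (X t @ concat (y t)) (d_observe D)"
          "lin_holds (concat (y t) @ concat (h t) @ concat (a t) @ concat (h (Suc t))) (d_policy D)"
          "lin_holds (X t @ concat (a t) @ X (Suc t)) (d_trans D)"
          using run that(1) by (auto simp: unsafe_run_def y(2) h(2) a(2))
        \<comment> \<open>The order matters: the observation constraint identifies
          \<open>y t\<close> as a true observation, which makes the policy constraint applicable,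
          and that puts \<open>a t\<close> in the domain of the transition constraint.\<close>
        have obs: "joint_observe S (X t) = y t" using *(1) ob[OF in_S(1) y(1)] by blast
        then have "y t \<in> joint_observations S" using joint_observe_in[OF S(1) in_S(1)] by simp
        then have pol: "joint_policy S (y t, h t) = (a t, h (Suc t))"
          using *(2) po in_S(2) a(1) h(1) by blast
        then have "a t \<in> joint_actions S"
          using joint_policy_in[OF S(1) in_S] obs by simp
        then show ?thesis using *(3) tr[OF in_S(1) _ X] pol obs by simp
      qed
      have "reachable S (X t) (h t)" if "t \<le> k" for t
        using that
      proof (induction t)
        case (Suc t)
        then show ?case using step[of t] by (metis Suc_leD Suc_le_lessD reachable.step)
      qed (rule reachable.init[OF init])
      then have steps: "\<And>t. t < k \<Longrightarrow> joint_policy S (joint_observe S (X t), h t) = (a t, h (Suc t)) \<and>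
          X (Suc t) \<in> transition S (X t) (a t)"
        using step by simp
      obtain x g where xg: "path S x g" "x 0 \<in> init_env S" "g 0 \<in> joint_init_hiddens S"
          "\<And>t. t \<le> k \<Longrightarrow> x t = X t"
        by (rule extend_finite_run[where X = X and H = h and A = a and k = k, OF S init steps]) blast+
      have "ltl_holds x 0 (map_ltl \<nu> \<phi>)"
        using models xg(1-3) unfolding mas_models_def by blast
      then have "ltl_holds X 0 (map_ltl \<nu> \<phi>)"
        using ltl_holds_cong_bounded[OF \<phi>, of 0 x X] xg(4) by (simp add: k_def)
      then show False using run by (simp add: unsafe_run_def)
    qed
  next
    assume safe: "\<not> ?unsafe"
    show "mas_models S (map_ltl \<nu> \<phi>)"
      unfolding mas_models_def
    proof (intro allI impI, elim conjE, rule ccontr)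
      fix x h
      assume p: "path S x h" and init: "x 0 \<in> init_env S" "h 0 \<in> joint_init_hiddens S"
        and viol: "\<not> ltl_holds x 0 (map_ltl \<nu> \<phi>)"
      define y where "y t = joint_observe S (x t)" for t
      define a where "a t = fst (joint_policy S (y t, h t))" for t
      have in_S: "x t \<in> env S" "h t \<in> joint_hiddens S" for t using p by (auto simp: path_def)
      have pol: "joint_policy S (y t, h t) = (a t, h (Suc t))"
        and trans: "x (Suc t) \<in> transition S (x t) (a t)" for t
      proof -
        obtain b where b: "(b, h (Suc t)) = joint_policy S (y t, h t)"
            "x (Suc t) \<in> transition S (x t) b"
          using p unfolding path_def y_def by blast
        then have "a t = b" unfolding a_def by (metis fst_conv)
        then show "joint_policy S (y t, h t) = (a t, h (Suc t))"
          "x (Suc t) \<in> transition S (x t) (a t)"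
          using b by simp_all
      qed
      have y_in: "y t \<in> joint_observations S" for t
        unfolding y_def by (rule joint_observe_in[OF S(1) in_S(1)])
      have a_in: "a t \<in> joint_actions S" for t
        using joint_policy_in(1)[OF S(1) in_S] pol unfolding y_def by blast
      have vecs: "y t \<in> joint_vec ps" "h t \<in> joint_vec ns" "a t \<in> joint_vec qs" "x t \<in> vec m" for t
        using sub y_in in_S a_in env by blast+
      have "unsafe_run (d_trans D) (d_policy D) (d_observe D) (d_init_env D) (d_init_hiddens D)
          k (map_ltl \<nu> \<phi>) x (\<lambda>t. concat (y t)) (\<lambda>t. concat (h t)) (\<lambda>t. concat (a t))"
        unfolding unsafe_run_def
        using init viol pol trans
        by (simp add: ie ih ob po tr vecs in_S y_in a_in y_def[symmetric])
      moreover have "length (x t) = m" "length (concat (y t)) = sum_list ps"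
          "length (concat (h t)) = sum_list ns" "length (concat (a t)) = sum_list qs" for t
        using vecs[of t] by (simp_all only: length_concat_joint_vec) (simp add: vec_def)
      ultimately have ?unsafe
        unfolding dims k_def
        by (intro exI[of _ x] exI[of _ "\<lambda>t. concat (y t)"] exI[of _ "\<lambda>t. concat (h t)"]
          exI[of _ "\<lambda>t. concat (a t)"]) simp
      with safe show False by contradiction
    qed
  qed
qed

section \<open>Computability of the decision procedure\<close>

context effective_field
begin

lemma computable_dnf_and [computable_intros]:
  "computable \<nu> f \<Longrightarrow> computable \<nu> g \<Longrightarrow> computable \<nu> (\<lambda>x. dnf_and (f x) (g x))"
  by (rule computable_comp2) (unfold dnf_and_def, intro computable_intros)

lemma computable_shift_dnf [computable_intros]:
  "computable \<nu> f \<Longrightarrow> computable \<nu> g \<Longrightarrow> computable \<nu> (\<lambda>x. shift_dnf (f x) (g x))"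
  by (rule computable_comp2) (unfold shift_dnf_def, intro computable_intros)

lemma computable_lin_dnf [computable_intros]:
  assumes "computable \<nu> f" "computable \<nu> g" shows "computable \<nu> (\<lambda>x. lin_dnf (f x) (g x))"
proof (rule computable_comp2[OF _ assms])
  show "computable \<nu> (\<lambda>p. lin_dnf (fst p) (snd p))"
    by (rule computable_lin_rec[where
      le = "\<lambda>is c d. [[(zip (map of_rat c) is, - of_rat d, False)]]" and
      ls = "\<lambda>is c d. [[(zip (map of_rat c) is, - of_rat d, True)]]" and
      and' = "\<lambda>_. dnf_and" and or' = "\<lambda>_. (@)"])
      (simp_all only: lin_dnf.simps, (intro computable_intros)+)
qed

lemma computable_block_width [computable_intros]:
  "computable \<nu> f \<Longrightarrow> computable \<nu> g \<Longrightarrow> computable \<nu> h \<Longrightarrow> computable \<nu> k \<Longrightarrow>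
    computable \<nu> (\<lambda>x. block_width (f x) (g x) (h x) (k x))"
  unfolding block_width_def by (intro computable_intros)

text \<open>Formulas have no \<open>represents\<close> instance; the formula enters through
  \<open>ng\<close>, the pair of normal forms computed beforehand from its code.\<close>

lemma computable_unsafe_dnf:
  "computable \<nu> (\<lambda>(m, nq, np, nn, tr, po, ob, ie, ih, k, ng).
     unsafe_dnf m nq np nn tr po ob ie ih k (snd (ng :: row list list \<times> row list list)))"
  unfolding unsafe_dnf_def step_dnf_def case_prod_beta by (intro computable_intros)

lemma bounded_ltl_dnf_computable:
  obtains T where "computable \<nu> T"
    "\<And>m w \<phi>. bounded_ltl \<phi> \<Longrightarrow>
       represents \<nu> (T (prod_encode (m, w), ltl_encode \<phi>)) (ltl_dnf (m, w) (map_ltl \<nu> \<phi>))"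
proof -
  obtain T where "computable \<nu> T"
    "\<And>c x \<phi>. represents \<nu> c x \<Longrightarrow> bounded_ltl \<phi> \<Longrightarrow>
       represents \<nu> (T (c, ltl_encode \<phi>)) (ltl_dnf x (map_ltl \<nu> \<phi>))"
    by (rule computable_bounded_ltl_rec[where F = ltl_dnf and \<nu> = \<nu> and
      atom = "\<lambda>k c d. ([[(zip c (segment 0 (fst k)), - d, False)]],
        [[(zip (map uminus c) (segment 0 (fst k)), d, True)]])" and
      neg = "\<lambda>_ A. (snd A, fst A)" and
      and' = "\<lambda>_ A B. (dnf_and (fst A) (fst B), snd A @ snd B)" and
      or' = "\<lambda>_ A B. (fst A @ fst B, dnf_and (snd A) (snd B))" and
      next' = "\<lambda>k A. (shift_dnf (snd k) (fst A), shift_dnf (snd k) (snd A))"])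
      (simp_all only: ltl_dnf.simps, (intro computable_intros)+)
  then show thesis by (intro that[of T]) simp_all
qed

theorem bounded_ltl_verification_computable:
  obtains g where "rec_unary g"
    "\<And>D S \<phi>. mn_mas S \<Longrightarrow> deadlock_free S \<Longrightarrow> describes D S \<Longrightarrow> ltl_over (env_dim S) \<phi> \<Longrightarrow>
       bounded_ltl \<phi> \<Longrightarrow>
       g (prod_encode (desc_encode D, ltl_encode \<phi>)) = of_bool (mas_models S (map_ltl \<nu> \<phi>))"
proof -
  obtain T where T: "computable \<nu> T" "\<And>m w \<phi>. bounded_ltl \<phi> \<Longrightarrow>
       represents \<nu> (T (prod_encode (m, w), ltl_encode \<phi>)) (ltl_dnf (m, w) (map_ltl \<nu> \<phi>))"
    by (rule bounded_ltl_dnf_computable) blast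
  have "computable \<nu> (\<lambda>x. \<not> list_ex feasible ((\<lambda>(m, nq, np, nn, tr, po, ob, ie, ih, k, ng).
      unsafe_dnf m nq np nn tr po ob ie ih k (snd (ng :: row list list \<times> row list list))) x))"
    by (intro computable_intros computable_unsafe_dnf)
  then obtain u where u: "rec_unary u" "\<And>n x. represents \<nu> n x \<Longrightarrow> represents \<nu> (u n)
      (\<not> list_ex feasible ((\<lambda>(m, nq, np, nn, tr, po, ob, ie, ih, k, ng).
      unsafe_dnf m nq np nn tr po ob ie ih k (snd (ng :: row list list \<times> row list list))) x))"
    by (rule computableE) blast
  \<comment> \<open>\<open>el i\<close> reads field \<open>i\<close> of the coded description. Field
    1 is the list of agents, and \<open>dim\<close> sums their action (0), observation (1) or
    hidden-state (2) dimensions.\<close>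
  define el where "el i n = head0 (drop i (list_decode n))" for i n
  define dim where "dim i n = sum_list (map (el i) (list_decode (el 1 n)))" for i n
  define width where "width n = block_width (el 0 n) (dim 0 n) (dim 1 n) (dim 2 n)" for n
  \<comment> \<open>\<open>f\<close>, the code of the formula, occurs twice: as the number of steps
    and as the input from which \<open>T\<close> computes the normal forms.\<close>
  define pack where "pack d f = prod_encode (el 0 d, prod_encode (dim 0 d, prod_encode (dim 1 d,
      prod_encode (dim 2 d, prod_encode (el 2 d, prod_encode (el 3 d, prod_encode (el 4 d,
      prod_encode (el 5 d, prod_encode (el 6 d, prod_encode (f,
        T (prod_encode (el 0 d, width d), f)))))))))))" for d f
  have el: "computable \<nu> (\<lambda>x. el i (f x))" if "computable \<nu> f" for i and f :: "nat \<Rightarrow> nat"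
    unfolding el_def by (intro computable_intros that)
  have el': "computable \<nu> (\<lambda>p :: nat \<times> nat. el i (snd p))" for i
    unfolding el_def by (intro computable_intros)
  have dim: "computable \<nu> (\<lambda>x. dim i (f x))" if "computable \<nu> f" for i and f :: "nat \<Rightarrow> nat"
    unfolding dim_def by (intro computable_intros el that el')
  have "computable \<nu> (\<lambda>n. u (pack (fst (prod_decode n)) (snd (prod_decode n))))"
    unfolding pack_def width_def
    by (intro computable_intros el dim computable_comp[OF T(1)]
      computable_comp[OF u(1)[folded computable_nat_iff[of \<nu>]]])
  then have rec: "rec_unary (\<lambda>n. u (pack (fst (prod_decode n)) (snd (prod_decode n))))"
    by (simp add: computable_nat_iff)
  have correct: "u (pack (desc_encode D) (ltl_encode \<phi>)) = of_bool (mas_models S (map_ltl \<nu> \<phi>))"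
    if S: "mn_mas S" "deadlock_free S" and D: "describes D S"
      and \<phi>: "ltl_over (env_dim S) \<phi>" "bounded_ltl \<phi>" for D S \<phi>
  proof -
    define m nq np nn where "m = env_dim S" and "nq = sum_list (map act_dim (agents S))"
      and "np = sum_list (map obs_dim (agents S))" and "nn = sum_list (map hid_dim (agents S))"
    define p where "p = map_ltl \<nu> \<phi>"
    note dims = m_def[symmetric] nq_def[symmetric] np_def[symmetric] nn_def[symmetric]
    note D' = D[unfolded describes_def Let_def dims]
    have m: "d_env_dim D = m"
      and ags: "d_agents D = map (\<lambda>ag. (act_dim ag, obs_dim ag, hid_dim ag)) (agents S)"
      and over: "lin_over (m + nq + m) (d_trans D)" "lin_over (np + nn + nq + nn) (d_policy D)"
        "lin_over (m + np) (d_observe D)" "lin_over m (d_init_env D)"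
        "lin_over nn (d_init_hiddens D)"
      using D' by - (elim conjE, assumption)+
    have els: "el 0 (desc_encode D) = m" "el 2 (desc_encode D) = lin_encode (d_trans D)"
      "el 3 (desc_encode D) = lin_encode (d_policy D)"
      "el 4 (desc_encode D) = lin_encode (d_observe D)"
      "el 5 (desc_encode D) = lin_encode (d_init_env D)"
      "el 6 (desc_encode D) = lin_encode (d_init_hiddens D)"
      by (simp_all add: el_def desc_encode_def m del: list_encode.simps)
    have el1: "list_decode (el 1 (desc_encode D)) =
        map (\<lambda>ag. list_encode [act_dim ag, obs_dim ag, hid_dim ag]) (agents S)"
      by (simp add: el_def desc_encode_def ags del: list_encode.simps)
    have ds: "dim 0 (desc_encode D) = nq" "dim 1 (desc_encode D) = np" "dim 2 (desc_encode D) = nn"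
      unfolding dim_def el1 nq_def np_def nn_def
      by (simp_all add: el_def comp_def del: list_encode.simps)
    define w where "w = block_width m nq np nn"
    have width: "width (desc_encode D) = w"
      by (simp only: width_def w_def els ds)
    have p: "bounded_ltl p" "ltl_over m p"
    proof -
      show "bounded_ltl p" unfolding p_def using \<phi>(2) by (induction \<phi>) auto
      show "ltl_over m p" unfolding p_def m_def using \<phi>(1) by (induction \<phi>) auto
    qed
    let ?U = "unsafe_dnf m nq np nn (d_trans D) (d_policy D) (d_observe D) (d_init_env D)
      (d_init_hiddens D) (ltl_encode \<phi>) (snd (ltl_dnf (m, w) p))"
    have "represents \<nu> (pack (desc_encode D) (ltl_encode \<phi>))
      (m, nq, np, nn, d_trans D, d_policy D, d_observe D, d_init_env D, d_init_hiddens D,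
       ltl_encode \<phi>, ltl_dnf (m, w) p)"
      unfolding pack_def els ds width p_def using T(2)[OF \<phi>(2), of m w] by simp
    from u(2)[OF this] have "u (pack (desc_encode D) (ltl_encode \<phi>)) = of_bool (\<not> list_ex feasible ?U)"
      by simp
    moreover have "list_ex feasible ?U \<longleftrightarrow> \<not> mas_models S (map_ltl \<nu> \<phi>)"
    proof -
      note iff = dnf_holds_unsafe_dnf[OF over p, folded w_def]
      note models = mas_models_iff_no_unsafe_run[OF S D \<phi>(2), unfolded dims]
      show ?thesis
      proof
        assume "list_ex feasible ?U"
        then obtain v where "dnf_holds v ?U" unfolding feasible_dnf_iff by blast
        note run = iff[THEN iffD1, OF this, unfolded p_def]
        show "\<not> mas_models S (map_ltl \<nu> \<phi>)"
          unfolding models not_not by (intro exI conjI[rotated], rule run) simp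
      next
        assume "\<not> mas_models S (map_ltl \<nu> \<phi>)"
        then obtain X Y H A where len: "\<And>t. length (X t) = m" "\<And>t. length (Y t) = np"
            "\<And>t. length (H t) = nn" "\<And>t. length (A t) = nq"
          and run: "unsafe_run (d_trans D) (d_policy D) (d_observe D) (d_init_env D)
            (d_init_hiddens D) (ltl_encode \<phi>) p X Y H A"
          unfolding models p_def by blast
        obtain v where
          "\<And>t. map v (segment (t * w) m) = X t" "\<And>t. map v (segment (t * w + m) np) = Y t"
          "\<And>t. map v (segment (t * w + m + np) nn) = H t"
          "\<And>t. map v (segment (t * w + m + np + nn) nq) = A t"
          using exists_block_layout[of X m Y np H nn A nq, OF len, folded w_def] by blast
        with run have "dnf_holds v ?U" unfolding iff by simp
        then show "list_ex feasible ?U" unfolding feasible_dnf_iff by blast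
      qed
    qed
    ultimately show ?thesis by simp
  qed
  show thesis
    by (rule that[OF rec]) (simp add: correct)
qed

end

theorem theorem3p4:
  fixes \<nu> :: "nat \<Rightarrow> real"
  assumes "effective_ordered_field \<nu>"
  shows "\<exists>f. recursive_fn 1 f \<and>
    (\<forall>D S \<phi>. mn_mas S \<and> deadlock_free S \<and> describes D S \<and>
        ltl_over (env_dim S) \<phi> \<and> bounded_ltl \<phi> \<longrightarrow>
      f [prod_encode (desc_encode D, ltl_encode \<phi>)] =
        (if mas_models S (map_ltl \<nu> \<phi>) then 1 else 0))"
proof -
  interpret effective_field \<nu> using assms by unfold_locales
  obtain g where g: "rec_unary g"
    "\<And>D S \<phi>. mn_mas S \<Longrightarrow> deadlock_free S \<Longrightarrow> describes D S \<Longrightarrow> ltl_over (env_dim S) \<phi> \<Longrightarrow>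
       bounded_ltl \<phi> \<Longrightarrow>
       g (prod_encode (desc_encode D, ltl_encode \<phi>)) = of_bool (mas_models S (map_ltl \<nu> \<phi>))"
    by (rule bounded_ltl_verification_computable) blast
  obtain f where f: "recursive_fn 1 f" "\<And>xs. length xs = 1 \<Longrightarrow> f xs = g (xs ! 0)"
    using g(1) unfolding rec_unary_def rec_ext_def by blast
  have "f [n] = g n" for n using f(2)[of "[n]"] by simp
  then show ?thesis using f(1) g(2) by (auto simp: of_bool_def)
qed

end
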